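(* Let $T$ be a tree of order at least two, and let $\mathcal{D}$ denote the set of vertices consisting of interior degree-two vertices and major vertices of terminal degree zero in $T$. Then (a) $\mathrm{cdim}(T)=1$ if $T$ is a path, and $\mathrm{cdim}(T)=|\mathcal{D}|+\sigma(T)$ if $T$ is not a path; (b) letting $\Gamma=\bigcup_{w \in \mathcal{M}_2(T)}(N[w] \cap V(T_w)) \cup \mathcal{M}_1(T) \cup \mathcal{D}$, for any $v \in V(T)$, $$\mathrm{cdim}_T(v)=\begin{cases} 1 & \text{if } \mathcal{M}(T)=\emptyset \text{ and } v \text{ is an end vertex},\\ 2 & \text{if } \mathcal{M}(T)=\emptyset \text{ and } v \text{ is not an end vertex},\\ |\mathcal{D}|+\sigma(T) & \text{if } \mathcal{M}(T)\neq\emptyset \text{ and } v \in \Gamma,\\ |\mathcal{D}|+\sigma(T)+d(v,u) & \text{if } \mathcal{M}(T)\neq\emptyset \text{ and } v \in V(\mathcal{T}_1)-\Gamma,\\ |\mathcal{D}|+\sigma(T)+d(v,u)-1 & \text{if } \mathcal{M}(T)\neq\emptyset \text{ and } v \in V(\mathcal{T}_2)-\Gamma, \end{cases}$$ where $d(v,u)$ denotes the distance between $v$ and its nearest major vertex $u$.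
   Context: All graphs are finite, simple, undirected; $d$ is the shortest-path distance. A set $S\subseteq V(G)$ is a resolving set of $G$ if for every pair of distinct vertices $x,y$ of $G$ there is $z\in S$ with $d(x,z)\ne d(y,z)$; it is a connected resolving set if moreover the induced subgraph $G[S]$ is connected. $\mathrm{cdim}(G)$ is the minimum cardinality of a connected resolving set of $G$, and $\mathrm{cdim}_G(v)$ is the minimum cardinality of a connected resolving set containing $v$. $N[w]$ is the closed neighborhood of $w$. An end vertex is a vertex of degree one; a major vertex is a vertex of degree at least three. An end vertex $\ell$ is a terminal vertex of a major vertex $v$ if $d(\ell,v)<d(\ell,w)$ for every other major vertex $w$. The terminal degree $ter_T(v)$ of a major vertex $v$ is the number of its terminal vertices; an exterior major vertex is a major vertex of positive terminal degree. $\sigma(T)$ is the number of end vertices of $T$. An interior degree-two vertex is a vertex of degree two such that the shortest path from it to any terminal vertex includes a major vertex. $\mathcal{M}(T)$ is the set of exterior major vertices of $T$, $\mathcal{M}_1(T)=\{w\in\mathcal{M}(T): ter_T(w)=1\}$, $\mathcal{M}_2(T)=\{w\in\mathcal{M}(T): ter_T(w)\ge 2\}$. For $v\in\mathcal{M}(T)$, $T_v$ is the subtree of $T$ induced by $v$ and all vertices on the paths joining $v$ to its terminal vertices. $V(\mathcal{T}_1)=\bigcup_{v\in\mathcal{M}_1(T)}V(T_v)$ and $V(\mathcal{T}_2)=\bigcup_{v\in\mathcal{M}_2(T)}V(T_v)$. *)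

theory Defs
  imports "Graph_Theory.Graph_Theory"
begin

text \<open>
  A finite simple undirected graph is an instance of the AFP locale \<open>graph\<close>: every edge is
  represented by two opposite arcs, so \<open>out_degree\<close> is the usual degree and the length of an
  \<open>awalk\<close> is its number of edges.

  The AFP predicates \<open>forest\<close> and \<open>tree\<close> cannot be used for such graphs, since they count the
  back-and-forth walk \<open>a, b, a\<close> as a cycle; hence the bound on the length below.
\<close>

definition tree_graph :: "('a, 'b) pre_digraph \<Rightarrow> bool" where
  "tree_graph T \<longleftrightarrow> graph T \<and> connected T \<and> \<not> (\<exists>p. pre_digraph.cycle T p \<and> 3 \<le> length p)"

definition path_graph :: "('a, 'b) pre_digraph \<Rightarrow> bool" where
  "path_graph T \<longleftrightarrow> graph T \<and>
     (\<exists>xs. xs \<noteq> [] \<and> distinct xs \<and> verts T = set xs \<and>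
           arcs_ends T = set (vwalk_arcs xs) \<union> (set (vwalk_arcs xs))\<inverse>)"

text \<open>Only meaningful if \<open>u\<close> and \<open>v\<close> lie in the same component.\<close>

definition gdist :: "('a, 'b) pre_digraph \<Rightarrow> 'a \<Rightarrow> 'a \<Rightarrow> nat" where
  "gdist T u v = (LEAST n. \<exists>p. pre_digraph.awalk T u p v \<and> length p = n)"

definition shortest_path :: "('a, 'b) pre_digraph \<Rightarrow> 'a \<Rightarrow> 'b awalk \<Rightarrow> 'a \<Rightarrow> bool" where
  "shortest_path T u p v \<longleftrightarrow> pre_digraph.awalk T u p v \<and> length p = gdist T u v"

definition closed_nbhd :: "('a, 'b) pre_digraph \<Rightarrow> 'a \<Rightarrow> 'a set" where
  "closed_nbhd T w = insert w {x. w \<rightarrow>\<^bsub>T\<^esub> x}"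


subsection \<open>Connected metric dimension\<close>

definition resolving_set :: "('a, 'b) pre_digraph \<Rightarrow> 'a set \<Rightarrow> bool" where
  "resolving_set T S \<longleftrightarrow> S \<subseteq> verts T \<and>
     (\<forall>x \<in> verts T. \<forall>y \<in> verts T. x \<noteq> y \<longrightarrow> (\<exists>z \<in> S. gdist T x z \<noteq> gdist T y z))"

definition connected_resolving_set :: "('a, 'b) pre_digraph \<Rightarrow> 'a set \<Rightarrow> bool" where
  "connected_resolving_set T S \<longleftrightarrow> resolving_set T S \<and> connected (T \<restriction> S)"

text \<open>
  In a connected graph the whole vertex set is a connected resolving set, so both minima
  below are attained.
\<close>

definition cdim :: "('a, 'b) pre_digraph \<Rightarrow> nat" where
  "cdim T = (LEAST k. \<exists>S. connected_resolving_set T S \<and> card S = k)"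

definition cdim_at :: "('a, 'b) pre_digraph \<Rightarrow> 'a \<Rightarrow> nat" where
  "cdim_at T v = (LEAST k. \<exists>S. connected_resolving_set T S \<and> v \<in> S \<and> card S = k)"


subsection \<open>End vertices and major vertices\<close>

definition end_vertices :: "('a, 'b) pre_digraph \<Rightarrow> 'a set" where
  "end_vertices T = {v \<in> verts T. out_degree T v = 1}"

definition num_ends :: "('a, 'b) pre_digraph \<Rightarrow> nat" (\<open>\<sigma>\<close>) where
  "\<sigma> T = card (end_vertices T)"

definition major_vertices :: "('a, 'b) pre_digraph \<Rightarrow> 'a set" where
  "major_vertices T = {v \<in> verts T. 3 \<le> out_degree T v}"

text \<open>\<open>terminal_vertices T v\<close> is only meaningful for a major vertex \<open>v\<close>.\<close>

definition terminal_vertices :: "('a, 'b) pre_digraph \<Rightarrow> 'a \<Rightarrow> 'a set" where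
  "terminal_vertices T v =
     {l \<in> end_vertices T. \<forall>w \<in> major_vertices T. w \<noteq> v \<longrightarrow> gdist T l v < gdist T l w}"

definition ter :: "('a, 'b) pre_digraph \<Rightarrow> 'a \<Rightarrow> nat" where
  "ter T v = card (terminal_vertices T v)"

definition ext_major :: "('a, 'b) pre_digraph \<Rightarrow> 'a set" (\<open>\<M>\<close>) where
  "\<M> T = {v \<in> major_vertices T. 0 < ter T v}"

definition ext_major1 :: "('a, 'b) pre_digraph \<Rightarrow> 'a set" (\<open>\<M>\<^sub>1\<close>) where
  "\<M>\<^sub>1 T = {w \<in> \<M> T. ter T w = 1}"

definition ext_major2 :: "('a, 'b) pre_digraph \<Rightarrow> 'a set" (\<open>\<M>\<^sub>2\<close>) where
  "\<M>\<^sub>2 T = {w \<in> \<M> T. 2 \<le> ter T w}"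

text \<open>In a tree the shortest path between two vertices is unique.\<close>

definition interior_degree_two :: "('a, 'b) pre_digraph \<Rightarrow> 'a set" where
  "interior_degree_two T =
     {x \<in> verts T. out_degree T x = 2 \<and>
        (\<forall>v \<in> major_vertices T. \<forall>l \<in> terminal_vertices T v. \<forall>p. shortest_path T x p l \<longrightarrow>
           set (pre_digraph.awalk_verts T x p) \<inter> major_vertices T \<noteq> {})}"

definition D_set :: "('a, 'b) pre_digraph \<Rightarrow> 'a set" (\<open>\<D>\<close>) where
  "\<D> T = interior_degree_two T \<union> {v \<in> major_vertices T. ter T v = 0}"

definition terminal_subtree :: "('a, 'b) pre_digraph \<Rightarrow> 'a \<Rightarrow> ('a, 'b) pre_digraph" where
  "terminal_subtree T v =
     T \<restriction> insert v {x. \<exists>l \<in> terminal_vertices T v. \<exists>p. pre_digraph.apath T v p l \<and>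
                           x \<in> set (pre_digraph.awalk_verts T v p)}"

definition VT1 :: "('a, 'b) pre_digraph \<Rightarrow> 'a set" where
  "VT1 T = (\<Union>v \<in> \<M>\<^sub>1 T. verts (terminal_subtree T v))"

definition VT2 :: "('a, 'b) pre_digraph \<Rightarrow> 'a set" where
  "VT2 T = (\<Union>v \<in> \<M>\<^sub>2 T. verts (terminal_subtree T v))"

definition Gamma_set :: "('a, 'b) pre_digraph \<Rightarrow> 'a set" (\<open>\<Gamma>\<close>) where
  "\<Gamma> T = (\<Union>w \<in> \<M>\<^sub>2 T. closed_nbhd T w \<inter> verts (terminal_subtree T w)) \<union> \<M>\<^sub>1 T \<union> \<D> T"

text \<open>The distance from \<open>v\<close> to its nearest major vertex; only used when major vertices exist.\<close>

definition dist_nearest_major :: "('a, 'b) pre_digraph \<Rightarrow> 'a \<Rightarrow> nat" where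
  "dist_nearest_major T v = Min (gdist T v ` major_vertices T)"

end

theory Submission
  imports Defs
begin

text \<open>
  In a tree, removing a vertex \<open>x\<close> leaves one \<^emph>\<open>branch\<close> for every neighbour of \<open>x\<close>. Two vertices in
  different branches at \<open>x\<close> are joined only through \<open>x\<close>, so their distances add up there
  (\<open>separated\<close>). Everything below is drawn from this fact.

  Two vertices that a nonempty set \<open>S\<close> fails to distinguish are at even distance, and \<open>S\<close> misses the
  two branches at their midpoint that contain them. Conversely two neighbours of \<open>x\<close> whose branches
  are both missed are not distinguished. Hence \<open>S\<close> resolves the tree iff at every vertex it misses at
  most one branch (\<open>resolving_iff_branches\<close>). Also, \<open>S\<close> induces a connected subgraph iff it is
  nonempty and contains every vertex that lies on a shortest path between two of its members.

  Suppose that there is a major vertex. A connected resolving set meets two branches at each major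
  vertex, hence contains all of them, and hence the hull \<open>Core\<close> of the major vertices. What is left
  outside of \<open>Core\<close> are the legs: the branches at a major vertex \<open>w\<close> without further major vertices.
  A leg is a path from \<open>w\<close> to an end vertex, and this makes the legs at \<open>w\<close> correspond to the terminal
  vertices of \<open>w\<close> (\<open>bij_terminals_legs\<close>), and all legs to the end vertices of the tree. At \<open>w\<close> at
  most one leg is missed, so a connected resolving set contains the first vertices of all legs at \<open>w\<close>
  but one. Now \<open>Core\<close> is the disjoint union of \<open>\<D>\<close> and \<open>\<M>\<close> (\<open>Core_eq\<close>), so that the minimum is
  \<open>|\<D>| + |\<M>| + \<Sum>(ter w - 1) = |\<D>| + \<sigma>\<close>, the sum being taken over \<open>w \<in> \<M>\<close>; it is attained by
  \<open>Core\<close> together with these first vertices.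

  If a vertex \<open>v\<close> is prescribed that belongs to none of the minimum sets, then it lies inside a leg at
  some \<open>w\<close>, and the set must contain the whole path from \<open>w\<close> to \<open>v\<close> in addition. These are \<open>d(w, v)\<close>
  new vertices, except that the first of them is free of charge when \<open>w\<close> has another leg that can be
  left out instead (\<open>conn_res_leg\<close>).

  Without major vertices, only one branch at a vertex can be missed unless all of \<open>S\<close> is concentrated
  in a single vertex of degree two. So one end vertex, or any two adjacent vertices, suffice.
\<close>

section \<open>Trees as metric spaces\<close>

text \<open>
  The locale abstracts from walks: a tree is known through its vertex set and its distance
  function, and adjacency is distance one. The last assumption is what acyclicity amounts to: from
  \<open>x\<close>, exactly one neighbour leads towards \<open>z\<close>, and all the others lead
  away from it.
\<close>

locale tree_metric =
  fixes V :: "'a set" and d :: "'a \<Rightarrow> 'a \<Rightarrow> nat"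
  assumes finite_V: "finite V"
    and d_eq_0: "x \<in> V \<Longrightarrow> y \<in> V \<Longrightarrow> d x y = 0 \<longleftrightarrow> x = y"
    and d_sym: "x \<in> V \<Longrightarrow> y \<in> V \<Longrightarrow> d x y = d y x"
    and d_triangle: "x \<in> V \<Longrightarrow> y \<in> V \<Longrightarrow> z \<in> V \<Longrightarrow> d x z \<le> d x y + d y z"
    and d_toward: "x \<in> V \<Longrightarrow> z \<in> V \<Longrightarrow> x \<noteq> z \<Longrightarrow>
      \<exists>y \<in> V. d x y = 1 \<and> d x z = Suc (d y z) \<and>
        (\<forall>y' \<in> V. d x y' = 1 \<longrightarrow> y' \<noteq> y \<longrightarrow> d y' z = Suc (d x z))"
begin

definition nbrs :: "'a \<Rightarrow> 'a set" where
  "nbrs x = {y \<in> V. d x y = 1}"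

text \<open>
  The \<open>z\<close> with \<open>toward x z = y\<close> form the branch at \<open>x\<close>
  through \<open>y\<close>, so that \<open>toward x\<close> is constant exactly on the branches at
  \<open>x\<close>. The value \<open>toward x x\<close> is arbitrary.
\<close>

definition toward :: "'a \<Rightarrow> 'a \<Rightarrow> 'a" where
  "toward x z = (SOME y. y \<in> nbrs x \<and> d x z = Suc (d y z) \<and>
                   (\<forall>y' \<in> nbrs x. y' \<noteq> y \<longrightarrow> d y' z = Suc (d x z)))"

definition between :: "'a \<Rightarrow> 'a \<Rightarrow> 'a \<Rightarrow> bool" where
  "between a q b \<longleftrightarrow> a \<in> V \<and> q \<in> V \<and> b \<in> V \<and> d a b = d a q + d q b"

lemma d_self [simp]: "x \<in> V \<Longrightarrow> d x x = 0"
  by (simp add: d_eq_0)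

lemma d_pos: "x \<in> V \<Longrightarrow> y \<in> V \<Longrightarrow> x \<noteq> y \<Longrightarrow> 0 < d x y"
  using d_eq_0 by auto

lemma nbrsD:
  assumes "y \<in> nbrs x"
  shows "y \<in> V" "d x y = 1"
  using assms by (auto simp: nbrs_def)

lemma nbrs_sym: "x \<in> V \<Longrightarrow> y \<in> nbrs x \<Longrightarrow> x \<in> nbrs y"
  by (auto simp: nbrs_def d_sym)

lemma finite_nbrs [simp]: "finite (nbrs x)"
  using finite_V by (auto simp: nbrs_def)

lemma toward_aux:
  assumes "x \<in> V" "z \<in> V" "x \<noteq> z"
  shows "toward x z \<in> nbrs x \<and> d x z = Suc (d (toward x z) z) \<and>
    (\<forall>y' \<in> nbrs x. y' \<noteq> toward x z \<longrightarrow> d y' z = Suc (d x z))"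
proof -
  have "\<exists>y. y \<in> nbrs x \<and> d x z = Suc (d y z) \<and>
          (\<forall>y' \<in> nbrs x. y' \<noteq> y \<longrightarrow> d y' z = Suc (d x z))"
    using d_toward[OF assms] by (auto simp: nbrs_def)
  then show ?thesis
    unfolding toward_def by (rule someI_ex)
qed

lemma toward_nbrs: "x \<in> V \<Longrightarrow> z \<in> V \<Longrightarrow> x \<noteq> z \<Longrightarrow> toward x z \<in> nbrs x"
  and d_toward_Suc: "x \<in> V \<Longrightarrow> z \<in> V \<Longrightarrow> x \<noteq> z \<Longrightarrow> d x z = Suc (d (toward x z) z)"
  and d_away: "x \<in> V \<Longrightarrow> z \<in> V \<Longrightarrow> x \<noteq> z \<Longrightarrow> y \<in> nbrs x \<Longrightarrow> y \<noteq> toward x z \<Longrightarrow>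
    d y z = Suc (d x z)"
  using toward_aux by blast+

lemma toward_in_V [simp]: "x \<in> V \<Longrightarrow> z \<in> V \<Longrightarrow> x \<noteq> z \<Longrightarrow> toward x z \<in> V"
  using toward_nbrs nbrsD by blast

lemma toward_eqI:
  assumes "x \<in> V" "z \<in> V" "y \<in> nbrs x" "d y z \<le> d x z"
  shows "toward x z = y"
proof -
  have "x \<noteq> z"
    using assms d_eq_0[of y z] nbrsD[OF assms(3)] by auto
  then show ?thesis
    using d_away[of x z y] assms by fastforce
qed

lemma nbr_dist_cases:
  assumes "x \<in> V" "z \<in> V" "y \<in> nbrs x"
  shows "d y z = Suc (d x z) \<or> d x z = Suc (d y z)"
proof (cases "x = z")
  case True
  then show ?thesis using assms nbrsD[OF assms(3)] d_sym[of y x] by simp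
next
  case False
  then show ?thesis
    using d_toward_Suc[OF assms(1,2) False] d_away[OF assms(1,2) False assms(3)]
    by (cases "y = toward x z") simp_all
qed

lemma toward_nbr: "x \<in> V \<Longrightarrow> y \<in> nbrs x \<Longrightarrow> toward x y = y"
  by (rule toward_eqI) (auto simp: nbrs_def)

lemma nbrs_neq: "x \<in> V \<Longrightarrow> y \<in> nbrs x \<Longrightarrow> y \<noteq> x"
  by (auto simp: nbrs_def)

text \<open>
  If the ends \<open>u\<close> and \<open>u'\<close> of an edge lay in different branches at
  \<open>x\<close>, then each of them would be one step nearer to its own neighbour of
  \<open>x\<close> than to \<open>x\<close>, and one step farther from that of the other. The
  triangle inequalities along the edge do not allow this for both.
\<close>

lemma toward_adjacent:
  assumes "x \<in> V" "u \<in> V" "u' \<in> nbrs u" "u \<noteq> x" "u' \<noteq> x"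
  shows "toward x u = toward x u'"
proof (rule ccontr)
  let ?y = "toward x u" and ?y' = "toward x u'"
  assume ne: "?y \<noteq> ?y'"
  have u': "u' \<in> V" "d u u' = 1" "d u' u = 1"
    using nbrsD[OF assms(3)] assms(2) d_sym by auto
  have y: "?y \<in> nbrs x" "?y' \<in> nbrs x" "?y \<in> V" "?y' \<in> V"
    using toward_nbrs u' assms by (auto intro: toward_in_V)
  have 1: "d x u = Suc (d ?y u)" "d x u' = Suc (d ?y' u')"
    using d_toward_Suc assms u' by auto
  have 2: "d ?y' u = Suc (d x u)" "d ?y u' = Suc (d x u')"
    using d_away y ne assms u' by metis+
  have "d ?y u' \<le> d ?y u + 1" "d ?y' u \<le> d ?y' u' + 1"
    using d_triangle[of ?y u u'] d_triangle[of ?y' u' u] y u' assms by auto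
  then show False using 1 2 by linarith
qed

text \<open>
  Moving from \<open>b\<close> towards \<open>a\<close>, one stays in the branch of
  \<open>b\<close> until \<open>x\<close> is reached. The hypothesis includes the case \<open>b =
  x\<close>.
\<close>

lemma separated:
  assumes "x \<in> V" "a \<in> V" "b \<in> V" "a \<noteq> x" "b \<noteq> x \<Longrightarrow> toward x a \<noteq> toward x b"
  shows "between a x b"
proof -
  have "d b a = d b x + d x a"
    using assms(3,5)
  proof (induction "d b a" arbitrary: b rule: less_induct)
    case less
    show ?case
    proof (cases "b = x")
      case True
      then show ?thesis using assms by simp
    next
      case False
      have "b \<noteq> a" using less.prems False by auto
      define b' where "b' = toward b a"
      have b': "b' \<in> nbrs b" "b' \<in> V" "d b a = Suc (d b' a)" "d b b' = 1"
        using toward_nbrs[of b a] d_toward_Suc[of b a] nbrsD[of b' b] \<open>b \<noteq> a\<close> less.prems assms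
        by (auto simp: b'_def)
      have "d b' a = d b' x + d x a"
      proof (rule less.hyps)
        show "d b' a < d b a" using b' by simp
        show "b' \<in> V" by fact
        assume "b' \<noteq> x"
        then show "toward x a \<noteq> toward x b'"
          using toward_adjacent[of x b b'] less.prems False assms(1) b' by metis
      qed
      moreover have "d b x \<le> d b b' + d b' x" "d b a \<le> d b x + d x a"
        using d_triangle[of b b' x] d_triangle[of b x a] b' less.prems assms by auto
      ultimately show ?thesis using b' by linarith
    qed
  qed
  then show ?thesis
    unfolding between_def using assms d_sym by (metis add.commute)
qed

lemma between_toward_neq:
  assumes "between a q b" "q \<noteq> a" "q \<noteq> b"
  shows "toward q a \<noteq> toward q b"
proof
  assume eq: "toward q a = toward q b"
  let ?y = "toward q a"
  have V: "a \<in> V" "q \<in> V" "b \<in> V" and ab: "d a b = d a q + d q b"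
    using assms by (auto simp: between_def)
  have "d q a = Suc (d ?y a)" "d q b = Suc (d ?y b)"
    using d_toward_Suc[of q a] d_toward_Suc[of q b] eq V assms by auto
  moreover have "d a b \<le> d a ?y + d ?y b"
    using V assms by (intro d_triangle) auto
  moreover have "d a ?y = d ?y a" "d a q = d q a"
    using V assms by (auto intro!: d_sym)
  ultimately show False using ab by linarith
qed

lemma between_sym: "between a q b \<Longrightarrow> between b q a"
  unfolding between_def by (metis add.commute d_sym)

lemma betweenD:
  assumes "between a q b"
  shows "a \<in> V" "q \<in> V" "b \<in> V" "d a b = d a q + d q b"
  using assms by (auto simp: between_def)

lemma between_ends [simp]: "a \<in> V \<Longrightarrow> b \<in> V \<Longrightarrow> between a a b" "a \<in> V \<Longrightarrow> b \<in> V \<Longrightarrow> between a b b"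
  by (auto simp: between_def)

section \<open>Geodesics and convex sets\<close>

text \<open>
  A vertex \<open>r\<close> cannot share its branch at \<open>q\<close> with both \<open>a\<close>
  and \<open>b\<close>.
\<close>

lemma between_split:
  assumes "between a q b" "r \<in> V"
  shows "between r q a \<or> between r q b"
proof (cases "q = a \<or> q = b \<or> q = r")
  case True
  then show ?thesis using betweenD[OF assms(1)] assms(2) by auto
next
  case False
  then have "toward q a \<noteq> toward q b"
    using between_toward_neq assms by blast
  then have "toward q r \<noteq> toward q a \<or> toward q r \<noteq> toward q b" by auto
  then show ?thesis
    using separated[of q r a] separated[of q r b] False betweenD[OF assms(1)] assms(2) by blast
qed

lemma between_unique:
  assumes "between a q b" "between a q' b" "d a q = d a q'"
  shows "q = q'"
proof (rule ccontr)
  assume ne: "q \<noteq> q'"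
  note V = betweenD[OF assms(1)] betweenD[OF assms(2)]
  have p: "0 < d q q'" "d q q' = d q' q" "d q' a = d a q'" "d q' b = d b q'" "d q a = d a q" "d q b = d b q"
    using d_pos[of q q'] ne V d_sym by auto
  consider "between q' q a" | "between q' q b"
    using between_split[OF assms(1), of q'] V by blast
  then show False
    by cases (use V p assms(3) betweenD in fastforce)+
qed

lemma between_exists:
  assumes "a \<in> V" "b \<in> V" "k \<le> d a b"
  shows "\<exists>q. between a q b \<and> d a q = k"
  using assms(3)
proof (induction k)
  case 0
  then show ?case using assms by (intro exI[of _ a]) auto
next
  case (Suc k)
  then obtain q where q: "between a q b" "d a q = k" by auto
  note V = betweenD[OF q(1)]
  have "q \<noteq> b" using Suc.prems q by auto
  define p where "p = toward q b"
  have p: "p \<in> V" "d q p = 1" "d q b = Suc (d p b)"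
    using toward_nbrs[of q b] d_toward_Suc[of q b] nbrsD[of p q] \<open>q \<noteq> b\<close> V by (auto simp: p_def)
  have "d a p \<le> d a q + d q p" "d a b \<le> d a p + d p b"
    using d_triangle[of a q p] d_triangle[of a p b] V p by auto
  then have "d a p = Suc k" "d a b = d a p + d p b"
    using p q V by linarith+
  then show ?case using V p by (auto simp: between_def)
qed

lemma card_geodesic:
  assumes "a \<in> V" "b \<in> V"
  shows "card {q. between a q b} = Suc (d a b)"
proof -
  have "bij_betw (d a) {q. between a q b} {..d a b}"
    unfolding bij_betw_def
  proof
    show "inj_on (d a) {q. between a q b}"
      using between_unique by (auto intro!: inj_onI)
    show "d a ` {q. between a q b} = {..d a b}"
    proof
      show "d a ` {q. between a q b} \<subseteq> {..d a b}" by (auto simp: between_def)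
      show "{..d a b} \<subseteq> d a ` {q. between a q b}"
        using between_exists[OF assms] by force
    qed
  qed
  then show ?thesis using bij_betw_same_card by fastforce
qed

lemma between_toward:
  assumes "between r q a" "q \<noteq> a"
  shows "between r q (toward a r)"
proof -
  note V = betweenD[OF assms(1)]
  have ne: "a \<noteq> r" using assms V d_pos[of q a] by auto
  have qa: "0 < d q a" "d q a = d a q" "d r q = d q r" "d r a = d a r"
    using d_pos V assms d_sym by auto
  have "toward a q = toward a r"
  proof (rule ccontr)
    assume "\<not> ?thesis"
    then have "d q r = d q a + d a r"
      using separated[of a q r] V assms(2) betweenD(4) by blast
    then show False using V qa by linarith
  qed
  then have "d a q = Suc (d (toward a r) q)" "d a r = Suc (d (toward a r) r)"
    using d_toward_Suc V ne assms(2) by metis+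
  moreover have "toward a r \<in> V" using V ne by auto
  moreover have "d (toward a r) q = d q (toward a r)" "d (toward a r) r = d r (toward a r)"
    using d_sym calculation V by blast+
  ultimately show ?thesis using V qa by (auto simp: between_def)
qed

text \<open>
  For trees, this closure under shortest paths will turn out to be connectedness of the induced
  subgraph.
\<close>

definition convex :: "'a set \<Rightarrow> bool" where
  "convex S \<longleftrightarrow> (\<forall>a \<in> S. \<forall>b \<in> S. \<forall>q. between a q b \<longrightarrow> q \<in> S)"

text \<open>
  It is enough to be able to walk from every member to one fixed root \<open>r\<close> inside
  \<open>S\<close>: by \<open>between_split\<close>, a vertex between two members lies between
  \<open>r\<close> and one of them.
\<close>

lemma convexI:
  assumes "S \<subseteq> V" "r \<in> S" and step: "\<And>s. s \<in> S \<Longrightarrow> s \<noteq> r \<Longrightarrow> toward s r \<in> S"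
  shows "convex S"
proof -
  have root: "q \<in> S" if "a \<in> S" "between r q a" for q a
    using that
  proof (induction "d r a" arbitrary: a rule: less_induct)
    case less
    note V = betweenD[OF less.prems(2)]
    show ?case
    proof (cases "q = a")
      case False
      then have ne: "a \<noteq> r" using V d_pos[of q a] by auto
      have "d r (toward a r) < d r a"
        using d_toward_Suc[of a r] V ne d_sym[of r a] d_sym[of r "toward a r"] by auto
      then show ?thesis
        using less.hyps[of "toward a r"] step[of a] between_toward[OF less.prems(2) False] less.prems ne
        by blast
    qed (use less in auto)
  qed
  then show ?thesis
    unfolding convex_def using between_split assms by blast
qed

section \<open>Resolving sets in terms of branches\<close>

definition resolving :: "'a set \<Rightarrow> bool" where
  "resolving S \<longleftrightarrow> S \<subseteq> V \<and> (\<forall>x \<in> V. \<forall>y \<in> V. x \<noteq> y \<longrightarrow> (\<exists>z \<in> S. d x z \<noteq> d y z))"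

text \<open>
  Trees are bipartite: moving \<open>b\<close> by one step towards \<open>c\<close> changes two of
  the three distances by one.
\<close>

lemma even_perimeter:
  assumes "a \<in> V" "b \<in> V" "c \<in> V"
  shows "even (d a b + d b c + d a c)"
  using assms(2)
proof (induction "d b c" arbitrary: b rule: less_induct)
  case less
  show ?case
  proof (cases "b = c")
    case True
    then show ?thesis using less assms by simp
  next
    case False
    define p where "p = toward b c"
    have p: "p \<in> V" "p \<in> nbrs b" "d b c = Suc (d p c)"
      using toward_nbrs[of b c] d_toward_Suc[of b c] less.prems assms False by (auto simp: p_def)
    have *: "even (d a p + d p c + d a c)"
      using less.hyps[of p] p by auto
    have s: "d a b = d b a" "d a p = d p a" using d_sym assms p less.prems by auto
    have "d b a = Suc (d p a) \<or> d p a = Suc (d b a)"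
      using nbr_dist_cases[OF less.prems assms(1) p(2)] by blast
    then show ?thesis using * p s by auto
  qed
qed

text \<open>
  If \<open>y\<close> and \<open>y'\<close> are neighbours of \<open>x\<close>, then any vertex
  outside of their branches reaches both of them through \<open>x\<close>. Conversely, let
  \<open>u\<close> and \<open>v\<close> not be distinguished by \<open>S\<close>. As their
  distance is even, they have a midpoint \<open>x\<close>, and a member of \<open>S\<close> in the
  branch of \<open>u\<close> at \<open>x\<close> would be nearer to \<open>u\<close> than to
  \<open>v\<close>.
\<close>

lemma resolving_iff_branches:
  assumes "S \<subseteq> V" "S \<noteq> {}"
  shows "resolving S \<longleftrightarrow> (\<forall>x \<in> V. \<forall>y \<in> nbrs x. \<forall>y' \<in> nbrs x. y \<noteq> y' \<longrightarrow>
           (\<exists>z \<in> S. z \<noteq> x \<and> (toward x z = y \<or> toward x z = y')))" (is "_ \<longleftrightarrow> ?R")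
proof
  assume res: "resolving S"
  show ?R
  proof (intro ballI impI)
    fix x y y' assume x: "x \<in> V" and y: "y \<in> nbrs x" "y' \<in> nbrs x" "y \<noteq> y'"
    have V: "y \<in> V" "y' \<in> V" "d x y = 1" "d x y' = 1" using y nbrsD by auto
    obtain z where z: "z \<in> S" "d y z \<noteq> d y' z"
      using res y V unfolding resolving_def by blast
    have zV: "z \<in> V" using z assms by auto
    have "z \<noteq> x" using z V x d_sym[of y x] d_sym[of y' x] by auto
    moreover have "toward x z = y \<or> toward x z = y'"
      using d_away[of x z y] d_away[of x z y'] z y zV x \<open>z \<noteq> x\<close> by metis
    ultimately show "\<exists>z \<in> S. z \<noteq> x \<and> (toward x z = y \<or> toward x z = y')"
      using z by blast
  qed
next
  assume R: ?R
  have "\<exists>z \<in> S. d u z \<noteq> d v z" if uv: "u \<in> V" "v \<in> V" "u \<noteq> v" for u v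
  proof (rule ccontr)
    assume "\<not> ?thesis"
    then have eq: "d u z = d v z" if "z \<in> S" for z using that by auto
    obtain z0 where z0: "z0 \<in> S" "z0 \<in> V" using assms by auto
    have "even (d z0 u + d u v + d z0 v)" using even_perimeter z0 uv by auto
    then have "even (d u v)" using eq[OF z0(1)] d_sym z0 uv by auto
    then obtain k where k: "d u v = 2 * k" by blast
    then obtain x where x: "between u x v" "d u x = k"
      using between_exists[of u v k] uv by auto
    note V = betweenD[OF x(1)]
    have "0 < k" using d_pos[OF uv] k by simp
    have kv: "d x u = k" "d x v = k" using V x k d_sym by auto
    then have ne: "x \<noteq> u" "x \<noteq> v" using \<open>0 < k\<close> V by auto
    define y y' where "y = toward x u" and "y' = toward x v"
    have y: "y \<in> nbrs x" "y' \<in> nbrs x" "y \<noteq> y'"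
      using between_toward_neq[OF x(1)] toward_nbrs ne V by (auto simp: y_def y'_def)
    obtain z where z: "z \<in> S" "z \<noteq> x" "toward x z = y \<or> toward x z = y'"
      using R V y by blast
    have zV: "z \<in> V" using z assms by auto
    have *: False if "toward x z = toward x u" "toward x z \<noteq> toward x v" "d u z = d v z" "d x u = d x v"
        "x \<noteq> u" "x \<noteq> v" "z \<noteq> x" "u \<in> V" "v \<in> V" for u v
    proof -
      have "between z x v" using separated that zV V by metis
      moreover have "\<not> between z x u" using between_toward_neq that by blast
      then have "d z u \<noteq> d z x + d x u" using that V zV by (auto simp: between_def)
      ultimately show False using that betweenD[of z x v] d_sym[of z u] d_sym[of z v] zV by auto
    qed
    show False
      using z(3) *[of u v] *[of v u] eq[OF z(1)] kv ne z(2) uv y unfolding y_def y'_def by metis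
  qed
  then show "resolving S" using assms by (auto simp: resolving_def)
qed


section \<open>Major vertices, end vertices and legs\<close>

definition Maj :: "'a set" where
  "Maj = {x \<in> V. 3 \<le> card (nbrs x)}"

definition Ends :: "'a set" where
  "Ends = {x \<in> V. card (nbrs x) = 1}"

lemma MajD: "m \<in> Maj \<Longrightarrow> m \<in> V"
  by (simp add: Maj_def)

lemma EndsD: "l \<in> Ends \<Longrightarrow> l \<in> V"
  by (simp add: Ends_def)

lemma MajI3:
  assumes "x \<in> V" "a \<in> nbrs x" "b \<in> nbrs x" "c \<in> nbrs x" "a \<noteq> b" "a \<noteq> c" "b \<noteq> c"
  shows "x \<in> Maj"
proof -
  have "card {a, b, c} \<le> card (nbrs x)" using assms by (intro card_mono) auto
  then show ?thesis using assms by (simp add: Maj_def)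
qed

lemma Ends_unique_nbr:
  assumes "l \<in> Ends" "y \<in> nbrs l" "y' \<in> nbrs l"
  shows "y = y'"
proof -
  obtain z where "nbrs l = {z}" using assms(1) by (auto simp: Ends_def card_1_singleton_iff)
  then show ?thesis using assms by auto
qed

lemma Ends_toward:
  assumes "l \<in> Ends" "a \<in> V" "b \<in> V" "a \<noteq> l" "b \<noteq> l"
  shows "toward l a = toward l b"
  by (rule Ends_unique_nbr[OF assms(1)]) (use toward_nbrs assms EndsD in auto)

lemma Ends_between:
  assumes "l \<in> Ends" "between a l b"
  shows "l = a \<or> l = b"
  using between_toward_neq[OF assms(2)] Ends_toward[OF assms(1)] betweenD[OF assms(2)] by blast

text \<open>
  As long as no major vertex has been met, a branch has no room for two vertices at the same
  distance from its root: the two share their predecessor \<open>p\<close>, which would have three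
  neighbours and be major.
\<close>

lemma leg_unique:
  assumes "r \<in> V" "u \<in> V" "u' \<in> V" "u \<noteq> r" "u' \<noteq> r" "toward r u = toward r u'" "d r u = d r u'"
    and "\<And>m. m \<in> V \<Longrightarrow> m \<noteq> r \<Longrightarrow> toward r m = toward r u \<Longrightarrow> d r m < d r u \<Longrightarrow> m \<notin> Maj"
  shows "u = u'"
  using assms
proof (induction "d r u" arbitrary: u u' rule: less_induct)
  case less
  show ?case
  proof (cases "d r u = 1")
    case True
    then have "u \<in> nbrs r" "u' \<in> nbrs r" using less.prems by (auto simp: nbrs_def)
    then show ?thesis using toward_nbr less.prems by metis
  next
    case False
    define p p' where "p = toward u r" and "p' = toward u' r"
    have p: "p \<in> V" "p \<in> nbrs u" "u \<in> nbrs p" "d r u = Suc (d r p)"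
      using toward_nbrs[of u r] d_toward_Suc[of u r] d_sym[of r u] d_sym[of r p] nbrs_sym[of u p]
        less.prems by (auto simp: p_def)
    have p': "p' \<in> V" "p' \<in> nbrs u'" "u' \<in> nbrs p'" "d r u' = Suc (d r p')"
      using toward_nbrs[of u' r] d_toward_Suc[of u' r] d_sym[of r u'] d_sym[of r p'] nbrs_sym[of u' p']
        less.prems by (auto simp: p'_def)
    have "p \<noteq> r" using p less.prems False by auto
    have "p' \<noteq> r" using p' less.prems False by auto
    have br: "toward r u = toward r p" "toward r u' = toward r p'"
      using toward_adjacent p p' less.prems \<open>p \<noteq> r\<close> \<open>p' \<noteq> r\<close> by blast+
    have "p = p'"
      using less.hyps[of p p'] p p' \<open>p \<noteq> r\<close> \<open>p' \<noteq> r\<close> br less.prems(1,6,7,8) by simp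
    show ?thesis
    proof (rule ccontr)
      assume "u \<noteq> u'"
      have q: "toward p r \<in> nbrs p" "d p r = Suc (d (toward p r) r)"
        using toward_nbrs d_toward_Suc p \<open>p \<noteq> r\<close> less.prems by auto
      have "d p r = d r p" "d u r = d r u" "d u' r = d r u'" using d_sym p less.prems by auto
      then have "toward p r \<noteq> u" "toward p r \<noteq> u'" using q p p' less.prems(7) by auto
      then have "p \<in> Maj"
        using MajI3[of p "toward p r" u u'] q p p' \<open>p = p'\<close> \<open>u \<noteq> u'\<close> by auto
      moreover have "p \<notin> Maj" using less.prems(8)[of p] p br \<open>p \<noteq> r\<close> by auto
      ultimately show False by blast
    qed
  qed
qed

text \<open>
  For the same reason \<open>u\<close> is the only vertex of its branch at its distance from
  \<open>r\<close>, and every vertex farther out is reached through it.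
\<close>

lemma leg_linear:
  assumes "r \<in> V" "u \<in> V" "v \<in> V" "u \<noteq> r" "v \<noteq> r" "toward r u = toward r v" "d r u \<le> d r v"
    and noM: "\<And>m. m \<in> V \<Longrightarrow> m \<noteq> r \<Longrightarrow> toward r m = toward r u \<Longrightarrow> d r m < d r u \<Longrightarrow> m \<notin> Maj"
  shows "between r u v"
proof -
  obtain q where q: "between r q v" "d r q = d r u"
    using between_exists assms by blast
  note V = betweenD[OF q(1)]
  have "q \<noteq> r" using q d_pos[of r u] assms by auto
  have "toward r q = toward r v"
  proof (cases "q = v")
    case False
    then have "\<not> between q r v"
      using V d_sym[of q r] d_pos[of r q] \<open>q \<noteq> r\<close> by (auto simp: between_def)
    then show ?thesis using separated[of r q v] V \<open>q \<noteq> r\<close> by blast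
  qed simp
  then have "u = q"
    using leg_unique[of r u q] noM q V assms \<open>q \<noteq> r\<close> by metis
  then show ?thesis using q by simp
qed

text \<open>
  A vertex of the branch that is farthest from \<open>x\<close> has no neighbour other than the
  one towards \<open>x\<close>.
\<close>

lemma branch_has_end:
  assumes "x \<in> V" "y \<in> nbrs x"
  shows "\<exists>l \<in> Ends. l \<noteq> x \<and> toward x l = y"
proof -
  define B where "B = {z \<in> V. z \<noteq> x \<and> toward x z = y}"
  have "finite B" using finite_V by (auto simp: B_def)
  moreover have "y \<in> B" using assms toward_nbr nbrs_neq nbrsD by (auto simp: B_def)
  ultimately have "Max (d x ` B) \<in> d x ` B" "\<forall>z \<in> B. d x z \<le> Max (d x ` B)"
    by (auto intro!: Max_in)
  then obtain l where l: "l \<in> B" "\<And>z. z \<in> B \<Longrightarrow> d x z \<le> d x l" by auto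
  have lV: "l \<in> V" "l \<noteq> x" "toward x l = y" using l by (auto simp: B_def)
  have only: "y' = toward l x" if y': "y' \<in> nbrs l" for y'
  proof (rule ccontr)
    assume ne: "y' \<noteq> toward l x"
    then have "d y' x = Suc (d l x)" using d_away lV assms y' by auto
    then have far: "d x y' = Suc (d x l)" using d_sym lV assms nbrsD[OF y'] by auto
    then have "y' \<noteq> x" using assms by auto
    then have "y' \<in> B"
      using toward_adjacent[of x l y'] lV assms y' nbrsD[OF y'] by (auto simp: B_def)
    then show False using l(2) far by fastforce
  qed
  have "toward l x \<in> nbrs l" using toward_nbrs[of l x] lV assms by auto
  then have "nbrs l = {toward l x}" using only by blast
  then have "l \<in> Ends" using lV by (simp add: Ends_def)
  then show ?thesis using lV by auto
qed

text \<open>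
  A leg is represented by its first vertex, the neighbour of \<open>w\<close> in it.
\<close>

definition legs :: "'a \<Rightarrow> 'a set" where
  "legs w = {y \<in> nbrs w. \<forall>m \<in> Maj. m \<noteq> w \<longrightarrow> toward w m \<noteq> y}"

definition terminals :: "'a \<Rightarrow> 'a set" where
  "terminals w = {l \<in> Ends. \<forall>m \<in> Maj. m \<noteq> w \<longrightarrow> d l w < d l m}"

lemma Ends_not_Maj: "l \<in> Ends \<Longrightarrow> l \<notin> Maj"
  by (auto simp: Maj_def Ends_def)

lemma finite_legs [simp]: "finite (legs w)"
  by (simp add: legs_def)

text \<open>
  Seen from an end vertex \<open>l\<close>, the tree is a single branch, to which
  \<open>leg_linear\<close> applies up to the nearest major vertex \<open>w\<close>. In particular
  \<open>w\<close> is strictly nearer than all other major vertices, so that every end vertex is a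
  terminal vertex of exactly one major vertex.
\<close>

lemma nearest_Maj_between:
  assumes "l \<in> Ends" "w \<in> Maj" "m \<in> Maj" "\<And>m. m \<in> Maj \<Longrightarrow> d l w \<le> d l m"
  shows "between l w m"
proof (rule leg_linear)
  show "toward l w = toward l m"
    using Ends_toward Ends_not_Maj assms MajD by metis
qed (use assms MajD EndsD Ends_not_Maj in \<open>auto simp: not_less[symmetric]\<close>)

lemma terminals_between:
  assumes "l \<in> terminals w" "w \<in> Maj" "m \<in> Maj"
  shows "between l w m"
  by (rule nearest_Maj_between) (use assms in \<open>auto simp: terminals_def intro: less_imp_le\<close>)

lemma terminalsI_nearest:
  assumes "l \<in> Ends" "w \<in> Maj" "\<And>m. m \<in> Maj \<Longrightarrow> d l w \<le> d l m"
  shows "l \<in> terminals w"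
proof -
  have "d l w < d l m" if "m \<in> Maj" "m \<noteq> w" for m
    using nearest_Maj_between[OF assms(1,2) that(1) assms(3)] d_pos[of w m] that assms(2) MajD
    by (auto simp: between_def)
  then show ?thesis using assms by (auto simp: terminals_def)
qed

lemma Ends_eq_terminals:
  assumes "Maj \<noteq> {}"
  shows "Ends = (\<Union>w \<in> Maj. terminals w)"
proof
  show "Ends \<subseteq> (\<Union>w \<in> Maj. terminals w)"
  proof
    fix l assume l: "l \<in> Ends"
    obtain w where "w \<in> Maj" "\<And>m. m \<in> Maj \<Longrightarrow> d l w \<le> d l m"
      using ex_has_least_nat[of "\<lambda>w. w \<in> Maj" _ "d l"] assms by blast
    then show "l \<in> (\<Union>w \<in> Maj. terminals w)" using terminalsI_nearest l by blast
  qed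
qed (auto simp: terminals_def)

lemma terminals_disjoint: "w \<in> Maj \<Longrightarrow> w' \<in> Maj \<Longrightarrow> w \<noteq> w' \<Longrightarrow> terminals w \<inter> terminals w' = {}"
  by (fastforce simp: terminals_def)

lemma terminals_toward_legs:
  assumes "w \<in> Maj" "l \<in> terminals w"
  shows "toward w l \<in> legs w"
proof -
  have l: "l \<in> Ends" "l \<in> V" "w \<in> V" "l \<noteq> w"
    using assms Ends_not_Maj EndsD MajD by (auto simp: terminals_def)
  have "toward w m \<noteq> toward w l" if "m \<in> Maj" "m \<noteq> w" for m
    using between_toward_neq[OF terminals_between[OF assms(2,1) that(1)]] l that by metis
  then show ?thesis using toward_nbrs l by (auto simp: legs_def)
qed

lemma legs_branch_not_Maj:
  "y \<in> legs w \<Longrightarrow> z \<noteq> w \<Longrightarrow> toward w z = y \<Longrightarrow> z \<notin> Maj"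
  by (auto simp: legs_def)

text \<open>
  All major vertices other than \<open>w\<close> lie outside of the leg.
\<close>

lemma legs_branch_between:
  assumes "w \<in> Maj" "y \<in> legs w" "z \<in> V" "z \<noteq> w" "toward w z = y" "m \<in> Maj"
  shows "between z w m"
  by (rule separated) (use assms MajD legs_branch_not_Maj in auto)

text \<open>
  The leg of a terminal vertex \<open>l\<close> of \<open>w\<close> is the branch of
  \<open>l\<close> at \<open>w\<close>. Every leg contains an end vertex, and only one, since of
  two end vertices in a leg the nearer one would lie between \<open>w\<close> and the other one.
\<close>

lemma bij_terminals_legs:
  assumes "w \<in> Maj"
  shows "bij_betw (toward w) (terminals w) (legs w)"
  unfolding bij_betw_def
proof
  have wV: "w \<in> V" using assms MajD by auto
  show "toward w ` terminals w = legs w"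
  proof
    show "toward w ` terminals w \<subseteq> legs w" using terminals_toward_legs assms by auto
    show "legs w \<subseteq> toward w ` terminals w"
    proof
      fix y assume y: "y \<in> legs w"
      then obtain l where l: "l \<in> Ends" "l \<noteq> w" "toward w l = y"
        using branch_has_end[of w y] wV by (auto simp: legs_def)
      have "d l w < d l m" if "m \<in> Maj" "m \<noteq> w" for m
        using legs_branch_between[OF assms y _ l(2,3) that(1)] l d_pos[of w m] that wV MajD EndsD
        by (auto simp: between_def)
      then show "y \<in> toward w ` terminals w" using l by (auto simp: terminals_def)
    qed
  qed
  show "inj_on (toward w) (terminals w)"
  proof (rule inj_onI)
    fix l l' assume l: "l \<in> terminals w" "l' \<in> terminals w" "toward w l = toward w l'"
    have leg: "toward w l \<in> legs w" using terminals_toward_legs assms l by auto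
    have *: "a = b" if "a \<in> terminals w" "b \<in> terminals w" "toward w a = toward w l"
        "toward w b = toward w l" "d w a \<le> d w b" for a b
    proof -
      have ab: "a \<in> Ends" "b \<in> Ends" "a \<in> V" "b \<in> V" "a \<noteq> w" "b \<noteq> w"
        using that assms Ends_not_Maj EndsD by (auto simp: terminals_def)
      then have "between w a b"
        using that wV legs_branch_not_Maj[OF leg] by (intro leg_linear) auto
      then show ?thesis using Ends_between ab by blast
    qed
    show "l = l'"
      using *[of l l'] *[of l' l] l by (metis nat_le_linear)
  qed
qed

lemma card_terminals: "w \<in> Maj \<Longrightarrow> card (terminals w) = card (legs w)"
  using bij_betw_same_card[OF bij_terminals_legs] .

lemma card_Ends:
  assumes "Maj \<noteq> {}"
  shows "card Ends = (\<Sum>w \<in> Maj. card (legs w))"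
proof -
  have fin: "finite Maj" "\<And>w. finite (terminals w)"
    using finite_V by (auto simp: Maj_def terminals_def Ends_def)
  have "card Ends = (\<Sum>w \<in> Maj. card (terminals w))"
    unfolding Ends_eq_terminals[OF assms]
    using fin terminals_disjoint by (intro card_UN_disjoint) auto
  then show ?thesis using card_terminals by simp
qed

lemma legs_disjoint:
  assumes "w \<in> Maj" "w' \<in> Maj" "w \<noteq> w'"
  shows "legs w \<inter> legs w' = {}"
proof -
  have False if y: "y \<in> legs w" "y \<in> legs w'" for y
  proof -
    have "toward w y = y" "y \<noteq> w" "y \<in> V" "d y w' = 1" "d y w = 1"
      using toward_nbr nbrs_neq nbrsD d_sym y assms MajD unfolding legs_def by auto
    then have "1 = 1 + d w w'"
      using legs_branch_between[OF assms(1) y(1), of y w'] assms by (auto simp: between_def)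
    then show False using d_pos[of w w'] assms MajD by auto
  qed
  then show ?thesis by blast
qed

section \<open>The hull of the major vertices\<close>

definition Core :: "'a set" where
  "Core = {q. \<exists>m \<in> Maj. \<exists>m' \<in> Maj. between m q m'}"

lemma Maj_Core: "Maj \<subseteq> Core"
  using MajD by (force simp: Core_def)

lemma Core_V: "Core \<subseteq> V"
  by (auto simp: Core_def between_def)

text \<open>
  From a vertex \<open>z\<close> inside a leg at \<open>w\<close>, all major vertices are seen in
  the direction of \<open>w\<close>.
\<close>

lemma legs_not_Core:
  assumes "w \<in> Maj" "y \<in> legs w" "z \<in> V" "z \<noteq> w" "toward w z = y"
  shows "z \<notin> Core"
proof
  assume "z \<in> Core"
  then obtain m m' where m: "m \<in> Maj" "m' \<in> Maj" "between m z m'" by (auto simp: Core_def)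
  have "z \<noteq> m" "z \<noteq> m'" using legs_branch_not_Maj[OF assms(2,4,5)] m by auto
  then have ne: "toward z m \<noteq> toward z m'" using between_toward_neq m by blast
  have "toward z k = toward z w" if "k \<in> Maj" for k
  proof (cases "k = w")
    case False
    have "between z w k" using legs_branch_between assms that by blast
    then have "d z w < d z k" "d z k = d z w + d w k" using d_pos[of w k] False assms that MajD by (auto simp: between_def)
    have "\<not> between w z k"
      using \<open>between z w k\<close> d_pos[of w z] assms MajD d_sym[of w z] by (auto simp: between_def)
    then show ?thesis using separated[of z w k] assms that MajD by metis
  qed simp
  then show False using ne m by metis
qed

lemma legs_Core_disjoint: 
  assumes "w \<in> Maj"
  shows "legs w \<inter> Core = {}"
proof -
  have "y \<notin> Core" if "y \<in> legs w" for y
  proof (rule legs_not_Core[OF assms that])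
    have "y \<in> nbrs w" "w \<in> V" using that assms MajD by (auto simp: legs_def)
    then show "y \<in> V" "y \<noteq> w" "toward w y = y" using nbrsD nbrs_neq toward_nbr by auto
  qed
  then show ?thesis by blast
qed

lemma Core_not_Maj:
  assumes "Maj \<noteq> {}" "q \<in> V" "q \<notin> Maj"
  shows "q \<in> Core \<longleftrightarrow> card (nbrs q) = 2 \<and> (\<forall>y \<in> nbrs q. \<exists>m \<in> Maj. toward q m = y)"
proof
  assume "q \<in> Core"
  then obtain m m' where m: "m \<in> Maj" "m' \<in> Maj" "between m q m'" by (auto simp: Core_def)
  have ne: "q \<noteq> m" "q \<noteq> m'" using m assms by auto
  then have t: "toward q m \<noteq> toward q m'" "toward q m \<in> nbrs q" "toward q m' \<in> nbrs q"
    using between_toward_neq m toward_nbrs assms MajD by auto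
  have "card {toward q m, toward q m'} \<le> card (nbrs q)"
    using t by (intro card_mono) auto
  then have c: "card (nbrs q) = 2" using t assms by (auto simp: Maj_def)
  then have "nbrs q = {toward q m, toward q m'}"
    using t by (intro card_seteq[symmetric]) auto
  then show "card (nbrs q) = 2 \<and> (\<forall>y \<in> nbrs q. \<exists>m \<in> Maj. toward q m = y)"
    using c m by auto
next
  assume R: "card (nbrs q) = 2 \<and> (\<forall>y \<in> nbrs q. \<exists>m \<in> Maj. toward q m = y)"
  then obtain y y' where "nbrs q = {y, y'}" "y \<noteq> y'" by (auto simp: card_2_iff)
  then obtain m m' where m: "m \<in> Maj" "m' \<in> Maj" "toward q m = y" "toward q m' = y'" using R by auto
  then have "between m q m'" using separated[of q m m'] assms MajD \<open>y \<noteq> y'\<close> by blast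
  then show "q \<in> Core" using m by (auto simp: Core_def)
qed

text \<open>
  If \<open>q\<close> lies between \<open>a\<close> and \<open>b\<close> in \<open>Core\<close>,
  then the branch of \<open>a\<close> at \<open>q\<close> contains a major vertex, since
  \<open>a\<close> itself lies between two of them, and likewise the branch of \<open>b\<close>.
\<close>

lemma convex_Core: "convex Core"
  unfolding convex_def
proof (intro ballI allI impI)
  fix a b q assume a: "a \<in> Core" and b: "b \<in> Core" and q: "between a q b"
  obtain m1 m2 where m: "m1 \<in> Maj" "m2 \<in> Maj" "between m1 a m2" using a by (auto simp: Core_def)
  obtain n1 n2 where n: "n1 \<in> Maj" "n2 \<in> Maj" "between n1 b n2" using b by (auto simp: Core_def)
  note V = betweenD[OF q] MajD[OF m(1)] MajD[OF m(2)] MajD[OF n(1)] MajD[OF n(2)]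
  show "q \<in> Core"
  proof (cases "q = a \<or> q = b \<or> q \<in> Maj")
    case True
    then show ?thesis using a b Maj_Core by auto
  next
    case False
    have side: "\<exists>m \<in> Maj. toward q m = toward q c"
      if "c \<in> V" "c \<noteq> q" "m1 \<in> Maj" "m2 \<in> Maj" "between m1 c m2" for c m1 m2
    proof (rule ccontr)
      assume none: "\<not> ?thesis"
      have "between c q m1" "between c q m2"
        using none that V MajD by (auto intro!: separated)
      moreover have "d m1 m2 \<le> d m1 q + d q m2" using d_triangle V that MajD by auto
      moreover have "d m1 c = d c m1" "d m1 q = d q m1" using d_sym V that MajD by auto
      moreover have "0 < d c q" using d_pos that V by auto
      ultimately show False using that(5) by (auto simp: between_def)
    qed
    obtain k k' where k: "k \<in> Maj" "k' \<in> Maj" "toward q k = toward q a" "toward q k' = toward q b"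
      using side[of a m1 m2] side[of b n1 n2] m n False V by blast
    have "toward q a \<noteq> toward q b" using between_toward_neq q False by blast
    then have "between k q k'" using separated[of q k k'] k V MajD False by metis
    then show ?thesis using k by (auto simp: Core_def)
  qed
qed


definition InnerTwo :: "'a set" where
  "InnerTwo = {x \<in> V. card (nbrs x) = 2 \<and> (\<forall>v \<in> Maj. \<forall>l \<in> terminals v. \<exists>m \<in> Maj. between x m l)}"

text \<open>
  A vertex \<open>x\<close> of degree two belongs to \<open>Core\<close> iff both of its branches
  contain a major vertex. If one of them does not, then it contains an end vertex, and the path
  from \<open>x\<close> to it meets no major vertex. If both do, consider an end vertex
  \<open>l\<close> and its nearest major vertex \<open>v\<close>. Were \<open>x\<close> nearer to
  \<open>l\<close> than \<open>v\<close>, then by \<open>leg_linear\<close> all major vertices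
  would be separated from \<open>l\<close> by \<open>x\<close>, and the branch of \<open>l\<close>
  at \<open>x\<close> would contain none. So \<open>v\<close> lies between \<open>l\<close> and
  \<open>x\<close>.
\<close>

lemma InnerTwo_eq:
  assumes "Maj \<noteq> {}"
  shows "InnerTwo = Core - Maj"
proof
  show "InnerTwo \<subseteq> Core - Maj"
  proof
    fix x assume x: "x \<in> InnerTwo"
    then have xV: "x \<in> V" "x \<notin> Maj" "card (nbrs x) = 2" by (auto simp: InnerTwo_def Maj_def)
    have "\<exists>m \<in> Maj. toward x m = y" if y: "y \<in> nbrs x" for y
    proof -
      obtain l where l: "l \<in> Ends" "l \<noteq> x" "toward x l = y"
        using branch_has_end[OF xV(1) y] by blast
      then obtain v where "v \<in> Maj" "l \<in> terminals v" using Ends_eq_terminals[OF assms] by blast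
      then obtain m where m: "m \<in> Maj" "between x m l" using x unfolding InnerTwo_def by blast
      have "m \<noteq> x" using m xV by auto
      have "\<not> between m x l"
        using betweenD[OF m(2)] d_pos[of x m] \<open>m \<noteq> x\<close> by (auto simp: between_def)
      then have "toward x m = toward x l"
        using separated[of x m l] betweenD[OF m(2)] \<open>m \<noteq> x\<close> by blast
      then show ?thesis using m l by auto
    qed
    then show "x \<in> Core - Maj" using xV Core_not_Maj[OF assms] by auto
  qed
  show "Core - Maj \<subseteq> InnerTwo"
  proof
    fix x assume "x \<in> Core - Maj"
    then have x: "x \<in> V" "x \<notin> Maj" "card (nbrs x) = 2" "\<forall>y \<in> nbrs x. \<exists>m \<in> Maj. toward x m = y"
      using Core_V Core_not_Maj[OF assms] by auto
    have "between x v l" if v: "v \<in> Maj" "l \<in> terminals v" for v l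
    proof -
      have l: "l \<in> Ends" using v by (simp add: terminals_def)
      then have "card (nbrs l) = 1" by (simp add: Ends_def)
      then have l: "l \<in> Ends" "l \<in> V" "l \<noteq> x" "v \<noteq> l" "v \<in> V"
        using l v x(3) EndsD MajD Ends_not_Maj by auto
      have nearest: "d l v \<le> d l m" if "m \<in> Maj" for m
        using v that by (cases "m = v") (simp_all add: terminals_def less_imp_le)
      have "d l v \<le> d l x"
      proof (rule ccontr)
        assume far: "\<not> d l v \<le> d l x"
        have "toward x m \<noteq> toward x l" if m: "m \<in> Maj" for m
        proof -
          have "between l x m"
          proof (rule leg_linear)
            show "toward l x = toward l m" using Ends_toward l m x MajD Ends_not_Maj by blast
            show "d l x \<le> d l m" using far nearest[OF m] by simp
            show "m' \<notin> Maj" if "d l m' < d l x" for m' using nearest[of m'] far that by auto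
          qed (use l x m MajD Ends_not_Maj in auto)
          moreover have "x \<noteq> m" using x m by auto
          ultimately show ?thesis using between_toward_neq[of l x m] l by metis
        qed
        then show False using x(4) toward_nbrs[of x l] x(1) l by blast
      qed
      have "between l v x"
      proof (rule leg_linear)
        show "toward l v = toward l x" using Ends_toward l x by blast
        show "m' \<notin> Maj" if "d l m' < d l v" for m' using nearest[of m'] that by auto
      qed (use l x \<open>d l v \<le> d l x\<close> in auto)
      then show ?thesis by (rule between_sym)
    qed
    then show "x \<in> InnerTwo" using x by (auto simp: InnerTwo_def)
  qed
qed

definition ExtMaj :: "'a set" where
  "ExtMaj = {w \<in> Maj. 0 < card (legs w)}"

text \<open>
  These are the vertices of \<open>\<D>\<close>, the terminal degree being replaced by the number
  of legs.
\<close>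

definition Dset :: "'a set" where
  "Dset = InnerTwo \<union> {w \<in> Maj. card (legs w) = 0}"

lemma finite_Maj [simp]: "finite Maj"
  using finite_V by (simp add: Maj_def)

lemma finite_Core [simp]: "finite Core"
  using finite_V Core_V finite_subset by blast

lemma Core_eq:
  assumes "Maj \<noteq> {}"
  shows "Core = Dset \<union> ExtMaj" "Dset \<inter> ExtMaj = {}"
  using InnerTwo_eq[OF assms] Maj_Core by (auto simp: Dset_def ExtMaj_def)

lemma card_Core: "Maj \<noteq> {} \<Longrightarrow> card Core = card Dset + card ExtMaj"
  using Core_eq card_Un_disjoint[of Dset ExtMaj] finite_Core by (metis finite_Un)

text \<open>
  The truncated difference is harmless: a major vertex without legs contributes nothing to either
  side.
\<close>

lemma legs_count:
  assumes "Maj \<noteq> {}"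
  shows "(\<Sum>w \<in> Maj. card (legs w) - 1) + card ExtMaj = card Ends"
proof -
  have "card ExtMaj = (\<Sum>w \<in> Maj. if 0 < card (legs w) then 1 else 0)"
    unfolding ExtMaj_def by (simp only: card_eq_sum sum.inter_filter[OF finite_Maj])
  then have "(\<Sum>w \<in> Maj. card (legs w) - 1) + card ExtMaj =
      (\<Sum>w \<in> Maj. (card (legs w) - 1) + (if 0 < card (legs w) then 1 else 0))"
    by (simp only: sum.distrib)
  also have "\<dots> = (\<Sum>w \<in> Maj. card (legs w))"
    by (rule sum.cong) auto
  finally show ?thesis using card_Ends[OF assms] by simp
qed

section \<open>The lower bound for connected resolving sets\<close>

definition conn_res :: "'a set \<Rightarrow> bool" where
  "conn_res S \<longleftrightarrow> S \<noteq> {} \<and> convex S \<and> resolving S"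

lemma conn_res_V: "conn_res S \<Longrightarrow> S \<subseteq> V"
  by (simp add: conn_res_def resolving_def)

lemma conn_res_finite: "conn_res S \<Longrightarrow> finite S"
  using conn_res_V finite_V finite_subset by blast

lemma conn_res_branch:
  assumes "conn_res S" "x \<in> V" "y \<in> nbrs x" "y' \<in> nbrs x" "y \<noteq> y'"
  shows "\<exists>z \<in> S. z \<noteq> x \<and> (toward x z = y \<or> toward x z = y')"
  using assms resolving_iff_branches[of S] unfolding conn_res_def resolving_def by blast

lemma conn_res_between: "conn_res S \<Longrightarrow> a \<in> S \<Longrightarrow> b \<in> S \<Longrightarrow> between a q b \<Longrightarrow> q \<in> S"
  unfolding conn_res_def convex_def by blast

text \<open>
  If \<open>S\<close> has a member in some branch at \<open>x\<close>, then two further branches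
  remain, and \<open>S\<close> meets one of them. By convexity it contains \<open>x\<close>.
\<close>

lemma conn_res_Maj:
  assumes "conn_res S"
  shows "Maj \<subseteq> S"
proof
  fix x assume x: "x \<in> Maj"
  then have xV: "x \<in> V" by (rule MajD)
  obtain z1 where z1: "z1 \<in> S" using assms by (auto simp: conn_res_def)
  have z1V: "z1 \<in> V" using conn_res_V assms z1 by auto
  show "x \<in> S"
  proof (cases "z1 = x")
    case False
    have "card (nbrs x) \<le> Suc (card (nbrs x - {toward x z1}))"
      using card_Suc_Diff1[of "nbrs x" "toward x z1"] by (cases "toward x z1 \<in> nbrs x") simp_all
    then have "2 \<le> card (nbrs x - {toward x z1})"
      using x by (auto simp: Maj_def)
    then obtain T where "T \<subseteq> nbrs x - {toward x z1}" "card T = 2"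
      by (meson obtain_subset_with_card_n)
    then obtain y y' where y: "y \<in> nbrs x" "y' \<in> nbrs x" "y \<noteq> y'" "y \<noteq> toward x z1" "y' \<noteq> toward x z1"
      by (auto simp: card_2_iff)
    obtain z where "z \<in> S" "z \<noteq> x" "toward x z = y \<or> toward x z = y'"
      using conn_res_branch[OF assms xV y(1,2,3)] by blast
    moreover from this have "between z1 x z"
      using separated[of x z1 z] xV z1V conn_res_V[OF assms] False y(4,5) by auto
    ultimately show ?thesis using conn_res_between assms z1 by blast
  qed (use z1 in auto)
qed

lemma conn_res_Core: "conn_res S \<Longrightarrow> Core \<subseteq> S"
  using conn_res_Maj conn_res_between unfolding Core_def by blast

lemma between_first_step:
  assumes "x \<in> V" "z \<in> V" "z \<noteq> x"
  shows "between x (toward x z) z"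
  using d_toward_Suc[of x z] toward_nbrs[of x z] nbrsD assms by (auto simp: between_def)

text \<open>
  Of two legs whose first vertices are not in \<open>S\<close>, one is met by \<open>S\<close>,
  hence entered through its first vertex.
\<close>

lemma conn_res_legs:
  assumes "conn_res S" "w \<in> Maj"
  shows "card (legs w) - 1 \<le> card (legs w \<inter> S)"
proof -
  have wV: "w \<in> V" using assms MajD by auto
  have "y = y'" if y: "y \<in> legs w - S" "y' \<in> legs w - S" for y y'
  proof (rule ccontr)
    assume "y \<noteq> y'"
    then obtain z where z: "z \<in> S" "z \<noteq> w" "toward w z = y \<or> toward w z = y'"
      using conn_res_branch[OF assms(1) wV, of y y'] y by (auto simp: legs_def)
    have "toward w z \<in> S"
      using conn_res_between[OF assms(1) _ z(1) between_first_step] conn_res_Maj[OF assms(1)]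
        assms(2) wV z conn_res_V[OF assms(1)] by blast
    then show False using z y by auto
  qed
  then have "card (legs w - S) \<le> 1"
    by (simp add: card_le_Suc0_iff_eq)
  moreover have "card (legs w) = card (legs w \<inter> S) + card (legs w - S)"
    by (metis card_Diff_subset_Int card_mono finite_Int finite_legs inf_le1 le_add_diff_inverse)
  ultimately show ?thesis by simp
qed

text \<open>
  The set \<open>X\<close> collects the vertices that \<open>S\<close> contains beyond the
  unavoidable ones. It may overlap with a leg that is the only one at its vertex \<open>w\<close>,
  because that leg contributes \<open>card (legs w) - 1 = 0\<close>.
\<close>

lemma conn_res_card_lower:
  assumes "Maj \<noteq> {}" "conn_res S" "X \<subseteq> S" "X \<inter> Core = {}"
    and X: "\<And>w. w \<in> Maj \<Longrightarrow> X \<inter> legs w = {} \<or> card (legs w) = 1"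
  shows "card Dset + card Ends + card X \<le> card S"
proof -
  let ?L = "\<lambda>w. legs w \<inter> S - X"
  have finS: "finite S" "finite X" using conn_res_finite assms finite_subset by blast+
  have "(\<Sum>w \<in> Maj. card (legs w) - 1) \<le> (\<Sum>w \<in> Maj. card (?L w))"
  proof (rule sum_mono)
    fix w assume w: "w \<in> Maj"
    show "card (legs w) - 1 \<le> card (?L w)"
    proof (cases "X \<inter> legs w = {}")
      case True
      then have "?L w = legs w \<inter> S" by auto
      then show ?thesis using conn_res_legs assms w by simp
    next
      case False
      then show ?thesis using X[OF w] by simp
    qed
  qed
  also have "\<dots> = card (\<Union>w \<in> Maj. ?L w)"
    using legs_disjoint by (intro card_UN_disjoint[symmetric]) auto
  finally have 1: "(\<Sum>w \<in> Maj. card (legs w) - 1) \<le> card (\<Union>w \<in> Maj. ?L w)" .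
  have "card Core + card X + card (\<Union>w \<in> Maj. ?L w) = card (Core \<union> X) + card (\<Union>w \<in> Maj. ?L w)"
    using card_Un_disjoint[of Core X] assms(4) finS by (simp add: Int_commute)
  also have "\<dots> = card (Core \<union> X \<union> (\<Union>w \<in> Maj. ?L w))"
    using finS legs_Core_disjoint by (intro card_Un_disjoint[symmetric]) auto
  also have "\<dots> \<le> card S"
    using finS assms conn_res_Core by (intro card_mono) auto
  finally show ?thesis using 1 card_Core legs_count assms(1) by fastforce
qed

section \<open>Connected resolving sets of minimum size\<close>

text \<open>
  One leg \<open>omit w\<close> is left out at every major vertex \<open>w\<close>;
  \<open>X\<close> adds vertices on the way to a prescribed one.
\<close>

definition core_with_legs :: "('a \<Rightarrow> 'a) \<Rightarrow> 'a set \<Rightarrow> 'a set" where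
  "core_with_legs omit X = Core \<union> (\<Union>w \<in> Maj. legs w - {omit w}) \<union> X"

lemma card_core_with_legs:
  assumes "Maj \<noteq> {}" "\<And>w. w \<in> Maj \<Longrightarrow> legs w \<noteq> {} \<Longrightarrow> omit w \<in> legs w"
  shows "card (core_with_legs omit X) \<le> card Dset + card Ends + card X"
proof -
  have "card (core_with_legs omit X) \<le> card Core + card (\<Union>w \<in> Maj. legs w - {omit w}) + card X"
    unfolding core_with_legs_def by (meson add_le_mono card_Un_le le_refl order_trans)
  moreover have "card (\<Union>w \<in> Maj. legs w - {omit w}) \<le> (\<Sum>w \<in> Maj. card (legs w - {omit w}))"
    by (rule card_UN_le) simp
  moreover have "(\<Sum>w \<in> Maj. card (legs w - {omit w})) = (\<Sum>w \<in> Maj. card (legs w) - 1)"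
  proof (rule sum.cong)
    fix w assume "w \<in> Maj"
    then show "card (legs w - {omit w}) = card (legs w) - 1"
      using assms(2)[of w] by (cases "legs w = {}") (auto simp: card_Diff_singleton)
  qed simp
  ultimately show ?thesis using card_Core legs_count assms(1) by fastforce
qed

text \<open>
  At a major vertex \<open>x\<close>, a branch that is not a leg contains a major vertex, and all
  legs but one have their first vertex in the set. At any other vertex \<open>x\<close> there are
  at most two branches, and \<open>r\<close> lies in one of them.
\<close>

lemma conn_res_core_with_legs:
  assumes r: "r \<in> Maj" and X: "X \<subseteq> V" "\<And>s. s \<in> X \<Longrightarrow> s \<noteq> r \<Longrightarrow> toward s r \<in> core_with_legs omit X"
  shows "conn_res (core_with_legs omit X)"
proof -
  let ?S = "core_with_legs omit X"
  have rV: "r \<in> V" using r MajD by auto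
  have rS: "r \<in> ?S" using r Maj_Core by (auto simp: core_with_legs_def)
  have SV: "?S \<subseteq> V" using Core_V X nbrsD by (auto simp: core_with_legs_def legs_def)
  have cS: "Core \<subseteq> ?S" by (auto simp: core_with_legs_def)
  have "convex ?S"
  proof (rule convexI[OF SV rS])
    fix s assume s: "s \<in> ?S" "s \<noteq> r"
    then consider "s \<in> Core" | w where "w \<in> Maj" "s \<in> legs w" | "s \<in> X" by (auto simp: core_with_legs_def)
    then show "toward s r \<in> ?S"
    proof cases
      case 1
      have "between s (toward s r) r" using between_first_step 1 Core_V s(2) rV by auto
      then have "toward s r \<in> Core" using convex_Core 1 r Maj_Core unfolding convex_def by blast
      then show ?thesis using cS by auto
    next
      case 2
      have wV: "w \<in> V" using 2 MajD by auto
      have snb: "s \<in> nbrs w" using 2 by (simp add: legs_def)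
      note sn = snb nbrsD(1)[OF snb] nbrs_neq[OF wV snb] toward_nbr[OF wV snb] nbrs_sym[OF wV snb]
      have "between s w r" using legs_branch_between[OF 2] sn r by blast
      then have "toward s r = w" using sn rV by (intro toward_eqI) (auto simp: between_def)
      then show ?thesis using 2 Maj_Core cS by auto
    next
      case 3
      then show ?thesis using X s by auto
    qed
  qed
  moreover have "resolving ?S"
  proof (subst resolving_iff_branches)
    show "\<forall>x\<in>V. \<forall>y\<in>nbrs x. \<forall>y'\<in>nbrs x. y \<noteq> y' \<longrightarrow>
            (\<exists>z\<in>?S. z \<noteq> x \<and> (toward x z = y \<or> toward x z = y'))"
    proof (intro ballI impI)
      fix x y y' assume x: "x \<in> V" and y: "y \<in> nbrs x" "y' \<in> nbrs x" "y \<noteq> y'"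
      show "\<exists>z\<in>?S. z \<noteq> x \<and> (toward x z = y \<or> toward x z = y')"
      proof (cases "x \<in> Maj")
        case True
        show ?thesis
        proof (cases "y \<in> legs x \<and> y' \<in> legs x")
          case True
          then have "y \<in> ?S \<or> y' \<in> ?S"
            using \<open>x \<in> Maj\<close> y(3) by (auto simp: core_with_legs_def)
          then show ?thesis
            using toward_nbr[OF x y(1)] toward_nbr[OF x y(2)] nbrs_neq[OF x y(1)] nbrs_neq[OF x y(2)]
            by blast
        next
          case False
          then obtain m where "m \<in> Maj" "m \<noteq> x" "toward x m = y \<or> toward x m = y'"
            using y by (auto simp: legs_def)
          then show ?thesis using Maj_Core cS by blast
        qed
      next
        case False
        then have "x \<noteq> r" using r by auto
        then have "toward x r = y \<or> toward x r = y'"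
          using MajI3[of x y y' "toward x r"] False x y toward_nbrs[OF x rV] by blast
        then show ?thesis using rS \<open>x \<noteq> r\<close> by auto
      qed
    qed
  qed (use SV rS in auto)
  ultimately show ?thesis using rS by (auto simp: conn_res_def)
qed

text \<open>
  A leg to be left out at \<open>w\<close>, different from \<open>y\<close> if possible.
\<close>

definition omit_leg :: "'a \<Rightarrow> 'a \<Rightarrow> 'a" where
  "omit_leg y w = (SOME y'. y' \<in> legs w \<and> (2 \<le> card (legs w) \<longrightarrow> y' \<noteq> y))"

lemma omit_leg:
  assumes "legs w \<noteq> {}"
  shows "omit_leg y w \<in> legs w" "2 \<le> card (legs w) \<Longrightarrow> omit_leg y w \<noteq> y"
proof -
  have "\<exists>y'. y' \<in> legs w \<and> (2 \<le> card (legs w) \<longrightarrow> y' \<noteq> y)"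
  proof (rule ccontr)
    assume *: "\<not> ?thesis"
    then have "2 \<le> card (legs w)" "legs w \<subseteq> {y}" using assms by auto
    then show False using card_mono[of "{y}" "legs w"] by simp
  qed
  then have "omit_leg y w \<in> legs w \<and> (2 \<le> card (legs w) \<longrightarrow> omit_leg y w \<noteq> y)"
    unfolding omit_leg_def by (rule someI_ex)
  then show "omit_leg y w \<in> legs w" "2 \<le> card (legs w) \<Longrightarrow> omit_leg y w \<noteq> y" by auto
qed

lemma conn_res_small:
  assumes "Maj \<noteq> {}" "v \<in> Core \<or> (\<exists>w \<in> Maj. 2 \<le> card (legs w) \<and> v \<in> legs w)"
  shows "\<exists>S. conn_res S \<and> v \<in> S \<and> card S \<le> card Dset + card Ends"
proof (intro exI conjI)
  let ?S = "core_with_legs (omit_leg v) {}"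
  obtain r where "r \<in> Maj" using assms by auto
  then show "conn_res ?S" by (rule conn_res_core_with_legs) auto
  show "v \<in> ?S"
    using assms(2)
  proof
    assume "\<exists>w \<in> Maj. 2 \<le> card (legs w) \<and> v \<in> legs w"
    then obtain w where w: "w \<in> Maj" "2 \<le> card (legs w)" "v \<in> legs w" by blast
    then have "omit_leg v w \<noteq> v" using omit_leg(2)[of w v] by blast
    then show ?thesis using w by (auto simp: core_with_legs_def)
  qed (simp add: core_with_legs_def)
  show "card ?S \<le> card Dset + card Ends"
    using card_core_with_legs[of "omit_leg v" "{}"] assms omit_leg by auto
qed

text \<open>
  Let \<open>G\<close> be the path from \<open>w\<close> to a vertex \<open>v\<close> inside a
  leg, without \<open>w\<close>. Its vertices come in addition to \<open>Core\<close> and to the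
  first vertices of legs, with \<open>y\<close> as the only exception.
\<close>

lemma leg_geodesic:
  assumes w: "w \<in> Maj" and y: "y \<in> legs w" and v: "v \<in> V" "v \<noteq> w" "toward w v = y"
  defines "G \<equiv> {q. between w q v} - {w}"
  shows "card G = d w v" "y \<in> G" "v \<in> G" "G \<subseteq> V" "G \<inter> Core = {}" "G \<inter> legs w = {y}"
    "w' \<in> Maj \<Longrightarrow> w' \<noteq> w \<Longrightarrow> G \<inter> legs w' = {}" "s \<in> G \<Longrightarrow> toward s w \<in> insert w G"
proof -
  have wV: "w \<in> V" using w MajD by auto
  have "finite {q. between w q v}" by (rule finite_subset[OF _ finite_V]) (auto simp: between_def)
  then show "card G = d w v" using card_geodesic[of w v] wV v by (simp add: G_def)
  have yn: "y \<in> nbrs w" "y \<noteq> w" using y nbrs_neq wV by (auto simp: legs_def)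
  show yG: "y \<in> G" using between_first_step[of w v] v wV yn by (auto simp: G_def)
  show "v \<in> G" using v wV by (auto simp: G_def)
  show GV: "G \<subseteq> V" by (auto simp: G_def between_def)
  have br: "toward w q = y" if "q \<in> G" for q
  proof -
    have q: "between w q v" "q \<noteq> w" using that by (auto simp: G_def)
    have "\<not> between q w v"
      using betweenD[OF q(1)] d_pos[of q w] q(2) by (auto simp: between_def)
    then show ?thesis using separated[of w q v] betweenD[OF q(1)] q(2) v by blast
  qed
  show "G \<inter> Core = {}"
    using legs_not_Core[OF w y] br GV by (auto simp: G_def)
  show "G \<inter> legs w = {y}"
  proof -
    have "q = y" if "q \<in> G" "q \<in> legs w" for q
      using br[OF that(1)] toward_nbr[OF wV, of q] that(2) by (simp add: legs_def)
    then show ?thesis using yG y by blast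
  qed
  show "G \<inter> legs w' = {}" if w': "w' \<in> Maj" "w' \<noteq> w"
  proof -
    have False if q: "q \<in> G" "q \<in> legs w'" for q
    proof -
      have "q \<in> V" "q \<noteq> w" using q GV by (auto simp: G_def)
      then have "between q w w'" using legs_branch_between[OF w y _ _ br[OF q(1)]] w' by blast
      moreover have "q \<in> nbrs w'" using q(2) by (simp add: legs_def)
      then have "d q w' = 1" using nbrsD(2)[of q w'] d_sym[of q w'] \<open>q \<in> V\<close> MajD[OF w'(1)] by simp
      moreover have "0 < d q w" "0 < d w w'" using d_pos w' wV MajD \<open>q \<in> V\<close> \<open>q \<noteq> w\<close> by auto
      ultimately show False by (auto simp: between_def)
    qed
    then show ?thesis by blast
  qed
  show "toward s w \<in> insert w G" if s: "s \<in> G"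
  proof -
    have sb: "between w s v" "s \<noteq> w" using s by (auto simp: G_def)
    have t: "between s (toward s w) w" using between_first_step[of s w] betweenD[OF sb(1)] sb(2) by auto
    note V = betweenD[OF sb(1)] betweenD[OF t]
    have "d w v \<le> d w (toward s w) + d (toward s w) v" "d (toward s w) v \<le> d (toward s w) s + d s v"
      using d_triangle V by blast+
    moreover have "d s (toward s w) = d (toward s w) s" "d s w = d w s" "d (toward s w) w = d w (toward s w)"
      using d_sym V by blast+
    ultimately have "between w (toward s w) v" using V by (auto simp: between_def)
    then show ?thesis by (auto simp: G_def)
  qed
qed

text \<open>
  A connected resolving set with the member \<open>v\<close> contains the path \<open>G\<close>
  from \<open>w\<close> to \<open>v\<close>. If \<open>w\<close> has another leg, that one is left
  out, the first vertex \<open>y\<close> of \<open>G\<close> is among the unavoidable vertices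
  already, and only the others are new. If not, then all of \<open>G\<close> is new.
\<close>

lemma conn_res_leg:
  assumes w: "w \<in> Maj" and y: "y \<in> legs w" and v: "v \<in> V" "v \<noteq> w" "toward w v = y"
  shows "\<exists>S. conn_res S \<and> v \<in> S \<and>
           card S \<le> card Dset + card Ends + d w v - (if 2 \<le> card (legs w) then 1 else 0)" (is ?A)
    and "conn_res S \<Longrightarrow> v \<in> S \<Longrightarrow>
           card Dset + card Ends + d w v - (if 2 \<le> card (legs w) then 1 else 0) \<le> card S" (is "_ \<Longrightarrow> _ \<Longrightarrow> ?B")
proof -
  define G where "G = {q. between w q v} - {w}"
  \<comment> \<open>With a second leg at \<open>w\<close>, the vertex \<open>y\<close> is counted among the first vertices of legs already.\<close>
  define X where "X = G - (if 2 \<le> card (legs w) then {y} else {})"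
  note G = leg_geodesic[OF w y v, folded G_def]
  have wV: "w \<in> V" "Maj \<noteq> {}" using w MajD by auto
  have dp: "0 < d w v" using d_pos wV v by auto
  have finG: "finite G" using G(4) finite_V finite_subset by blast
  have cX: "card X = d w v - (if 2 \<le> card (legs w) then 1 else 0)"
    using G(1,2) finG by (auto simp: X_def)
  have lne: "legs w \<noteq> {}" using y by auto
  let ?S = "core_with_legs (omit_leg y) X"
  have GS: "G \<subseteq> ?S"
  proof
    fix q assume "q \<in> G"
    then show "q \<in> ?S"
      using omit_leg(2)[OF lne, of y] y w by (cases "q \<in> X") (auto simp: core_with_legs_def X_def split: if_splits)
  qed
  have "conn_res ?S"
  proof (rule conn_res_core_with_legs[OF w])
    show "X \<subseteq> V" using G(4) by (auto simp: X_def)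
    fix s assume "s \<in> X"
    then have "toward s w \<in> insert w G" using G(8) by (auto simp: X_def)
    then show "toward s w \<in> ?S" using GS Maj_Core w by (auto simp: core_with_legs_def)
  qed
  moreover have "card ?S \<le> card Dset + card Ends + card X"
    using card_core_with_legs wV(2) omit_leg(1) by blast
  ultimately show ?A using cX G(3) GS dp by (intro exI[of _ ?S]) auto
  show ?B if S: "conn_res S" "v \<in> S"
  proof -
    have "w \<in> S" using conn_res_Maj S w by auto
    then have "X \<subseteq> S" using conn_res_between[OF S(1) _ S(2)] by (auto simp: X_def G_def)
    moreover have "X \<inter> Core = {}" using G(5) by (auto simp: X_def)
    moreover have "X \<inter> legs w' = {} \<or> card (legs w') = 1" if "w' \<in> Maj" for w'
    proof (cases "w' = w")
      case True
      show ?thesis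
      proof (cases "2 \<le> card (legs w)")
        case two: True
        then show ?thesis using G(6) True by (auto simp: X_def)
      next
        case False
        moreover have "card (legs w) \<noteq> 0" using lne by simp
        ultimately have "card (legs w) = 1" by linarith
        then show ?thesis using True by simp
      qed
    next
      case False
      then show ?thesis using G(7)[OF that] by (auto simp: X_def)
    qed
    ultimately have "card Dset + card Ends + card X \<le> card S"
      by (rule conn_res_card_lower[OF wV(2) S(1)])
    then show ?thesis using cX dp by auto
  qed
qed

section \<open>Trees without major vertices\<close>

text \<open>
  Now there are at most two branches at any vertex \<open>x\<close>, so that a single member of
  \<open>S\<close> other than \<open>x\<close> suffices.
\<close>

lemma conn_res_no_Maj:
  assumes "Maj = {}" "S \<subseteq> V" "S \<noteq> {}" "convex S"
    "\<And>x. x \<in> V \<Longrightarrow> x \<notin> Ends \<Longrightarrow> \<exists>z \<in> S. z \<noteq> x"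
  shows "conn_res S"
proof -
  have "\<exists>z\<in>S. z \<noteq> x \<and> (toward x z = y \<or> toward x z = y')"
    if x: "x \<in> V" and y: "y \<in> nbrs x" "y' \<in> nbrs x" "y \<noteq> y'" for x y y'
  proof -
    have "x \<notin> Ends" using Ends_unique_nbr y by blast
    then obtain z where z: "z \<in> S" "z \<noteq> x" using assms(5) x by blast
    then have "toward x z = y \<or> toward x z = y'"
      using MajI3[of x y y' "toward x z"] toward_nbrs[of x z] assms(1,2) x y by blast
    then show ?thesis using z by blast
  qed
  then show ?thesis
    using assms resolving_iff_branches[of S] by (auto simp: conn_res_def)
qed

lemma conn_res_end:
  assumes "Maj = {}" "v \<in> Ends"
  shows "conn_res {v}"
proof (rule conn_res_no_Maj)
  show "convex {v}" using EndsD[OF assms(2)] by (intro convexI[of _ v]) auto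
qed (use assms EndsD in auto)

lemma conn_res_edge:
  assumes "Maj = {}" "v \<in> V" "y \<in> nbrs v"
  shows "conn_res {v, y}"
proof (rule conn_res_no_Maj)
  have y: "y \<in> V" "y \<noteq> v" "v \<in> nbrs y" using assms nbrsD nbrs_neq nbrs_sym by blast+
  have "toward y v = v" using toward_nbr y by blast
  then show "convex {v, y}" "{v, y} \<subseteq> V" using y(1) assms(2) by (auto intro!: convexI[of _ v])
  show "\<exists>z \<in> {v, y}. z \<noteq> x" for x using y(2) by auto
qed (use assms in auto)

lemma conn_res_not_end:
  assumes "conn_res S" "v \<in> S" "v \<notin> Ends" "nbrs v \<noteq> {}"
  shows "2 \<le> card S"
proof -
  have vV: "v \<in> V" using conn_res_V assms by auto
  then have "card (nbrs v) \<noteq> 1" "card (nbrs v) \<noteq> 0" using assms by (auto simp: Ends_def)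
  then have "\<not> card (nbrs v) \<le> Suc 0" by linarith
  then obtain y y' where "y \<in> nbrs v" "y' \<in> nbrs v" "y \<noteq> y'"
    by (auto simp: card_le_Suc0_iff_eq)
  then obtain z where "z \<in> S" "z \<noteq> v" using conn_res_branch[OF assms(1) vV] by blast
  then have "card {v, z} \<le> card S" using assms conn_res_finite by (intro card_mono) auto
  then show ?thesis using \<open>z \<noteq> v\<close> by simp
qed

lemma Ends_nonempty:
  assumes "2 \<le> card V"
  shows "Ends \<noteq> {}"
proof -
  have "\<not> card V \<le> Suc 0" using assms by simp
  then obtain x z where xz: "x \<in> V" "z \<in> V" "x \<noteq> z"
    using finite_V by (auto simp: card_le_Suc0_iff_eq)
  then show ?thesis using branch_has_end[OF xz(1) toward_nbrs[OF xz]] by auto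
qed

text \<open>
  Seen from an end vertex, the whole tree is one leg.
\<close>

lemma inj_on_dist_end:
  assumes "Maj = {}" "l \<in> Ends"
  shows "inj_on (d l) V"
proof (rule inj_onI)
  fix u u' assume u: "u \<in> V" "u' \<in> V" "d l u = d l u'"
  have lV: "l \<in> V" using assms EndsD by auto
  show "u = u'"
  proof (cases "u = l \<or> u' = l")
    case True
    then have "d l u = 0 \<and> d l u' = 0" using u lV by auto
    then show ?thesis using u lV d_eq_0[of l u] d_eq_0[of l u'] by simp
  next
    case False
    then show ?thesis
      using leg_unique[of l u u'] Ends_toward[OF assms(2)] u lV assms(1) by blast
  qed
qed

end

section \<open>The metric of a finite tree\<close>

locale fin_tree = graph G for G :: "('a, 'b) pre_digraph" (structure) +
  assumes conn: "connected G" and acyclic_graph: "\<not> (\<exists>p. cycle p \<and> 3 \<le> length p)"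

lemma tree_graph_iff: "tree_graph T \<longleftrightarrow> fin_tree T"
  by (simp add: tree_graph_def fin_tree_def fin_tree_axioms_def)

context fin_tree
begin

abbreviation dist :: "'a \<Rightarrow> 'a \<Rightarrow> nat" where "dist \<equiv> gdist G"

lemma adj_sym: "u \<rightarrow> v \<Longrightarrow> v \<rightarrow> u"
  by (rule arcs_ends_symmetric[OF sym_arcs])

lemma awalk_exists:
  assumes "u \<in> verts G" "v \<in> verts G"
  shows "\<exists>p. awalk u p v"
  using symmetric_connected_imp_strongly_connected[OF sym_arcs conn] assms
  unfolding strongly_connected_def reachable_awalk by blast

lemma dist_le: "awalk u p v \<Longrightarrow> dist u v \<le> length p"
  unfolding gdist_def by (rule Least_le) blast

lemma shortest_exists:
  assumes "u \<in> verts G" "v \<in> verts G"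
  shows "\<exists>p. awalk u p v \<and> length p = dist u v"
proof -
  obtain p where "awalk u p v" using awalk_exists assms by blast
  then have "\<exists>p'. awalk u p' v \<and> length p' = length p" by blast
  then show ?thesis unfolding gdist_def by (rule LeastI)
qed

lemma awalk_reverse:
  assumes "awalk u p v"
  shows "\<exists>q. awalk v q u \<and> length q = length p \<and> set (awalk_verts v q) = set (awalk_verts u p)"
  using assms
proof (induction p arbitrary: u)
  case Nil
  then show ?case by (intro exI[of _ "[]"]) (auto simp: awalk_Nil_iff)
next
  case (Cons e p)
  then have e: "e \<in> arcs G" "u = tail G e" "awalk (head G e) p v" by (simp_all add: awalk_Cons_iff)
  then obtain q where q: "awalk v q (head G e)" "length q = length p"
      "set (awalk_verts v q) = set (awalk_verts (head G e) p)"
    using Cons.IH by blast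
  obtain e' where e': "e' \<in> arcs G" "tail G e' = head G e" "head G e' = u"
    using e sym_arcs unfolding symmetric_conv by metis
  have bk: "awalk (head G e) [e'] u"
    using arc_implies_awalk[OF e'(1), unfolded e'(2,3)] .
  have "set (awalk_verts v (q @ [e'])) = insert u (insert (head G e) (set (awalk_verts v q)))"
    using set_awalk_verts_append[OF q(1) bk] e'(2,3) by auto
  also have "\<dots> = set (awalk_verts u (e # p))"
    using q(3) hd_in_awalk_verts(1)[OF e(3)] e(2) by (simp add: insert_absorb)
  finally show ?case
    using awalk_appendI[OF q(1) bk] q(2) by (intro exI[of _ "q @ [e']"]) simp
qed

lemma dist_sym:
  assumes "u \<in> verts G" "v \<in> verts G"
  shows "dist u v = dist v u"
proof -
  have "dist b a \<le> dist a b" if V: "a \<in> verts G" "b \<in> verts G" for a b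
  proof -
    obtain p where p: "awalk a p b" "length p = dist a b" using shortest_exists[OF V] by blast
    obtain q where q: "awalk b q a" "length q = length p" using awalk_reverse[OF p(1)] by blast
    show ?thesis using dist_le[OF q(1)] p(2) q(2) by simp
  qed
  then show ?thesis using assms by (blast intro: le_antisym)
qed

lemma dist_triangle:
  assumes "u \<in> verts G" "v \<in> verts G" "w \<in> verts G"
  shows "dist u w \<le> dist u v + dist v w"
proof -
  obtain p q where "awalk u p v" "length p = dist u v" "awalk v q w" "length q = dist v w"
    using shortest_exists assms by metis
  then show ?thesis using dist_le[OF awalk_appendI[of u p v q w]] by simp
qed

lemma dist_eq_0:
  assumes "u \<in> verts G" "v \<in> verts G"
  shows "dist u v = 0 \<longleftrightarrow> u = v"
proof
  assume "dist u v = 0"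
  then obtain p where "awalk u p v" "p = []" using shortest_exists[OF assms] by auto
  then show "u = v" by (simp add: awalk_Nil_iff)
next
  assume "u = v"
  then have "awalk u [] v" using assms by (simp add: awalk_Nil_iff)
  then show "dist u v = 0" using dist_le[of u "[]" v] by simp
qed

lemma dist_eq_1:
  assumes "u \<in> verts G" "v \<in> verts G"
  shows "dist u v = 1 \<longleftrightarrow> u \<rightarrow> v"
proof
  assume "dist u v = 1"
  then obtain p where p: "awalk u p v" "length p = 1" using shortest_exists[OF assms] by auto
  then obtain e where "p = [e]" by (auto simp: length_Suc_conv)
  then show "u \<rightarrow> v"
    using p in_arcs_imp_in_arcs_ends by (auto simp: awalk_Cons_iff awalk_Nil_iff)
next
  assume uv: "u \<rightarrow> v"
  then obtain e where e: "e \<in> arcs G" "tail G e = u" "head G e = v" by auto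
  then have "dist u v \<le> 1" using dist_le[OF arc_implies_awalk[OF e(1)]] by simp
  moreover have "u \<noteq> v" using uv adj_not_same by auto
  ultimately show "dist u v = 1" using dist_eq_0[OF assms] by linarith
qed

text \<open>
  A walk between two neighbours of \<open>x\<close> that avoids \<open>x\<close> can be shortened
  to a path, and closed to a cycle through \<open>x\<close>. It has at least three arcs, since
  \<open>y\<close> and \<open>y'\<close> differ.
\<close>

lemma no_bypass:
  assumes "x \<rightarrow> y" "x \<rightarrow> y'" "y \<noteq> y'" "awalk y p y'" "x \<notin> set (awalk_verts y p)"
  shows False
proof -
  define q where "q = awalk_to_apath p"
  have q: "apath y q y'" "set q \<subseteq> set p"
    using apath_awalk_to_apath[OF assms(4)] awalk_to_apath_subset[OF assms(4)] by (simp_all add: q_def)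
  have qw: "awalk y q y'" "distinct (awalk_verts y q)" using q(1) by (simp_all add: apath_def)
  have xq: "x \<notin> set (awalk_verts y q)"
    using q(2) assms(5) unfolding set_awalk_verts[OF assms(4)] set_awalk_verts[OF qw(1)] by auto
  have "q \<noteq> []"
  proof
    assume "q = []"
    then show False using qw(1) assms(3) by (simp add: awalk_Nil_iff)
  qed
  obtain e where e: "e \<in> arcs G" "tail G e = x" "head G e = y"
    using assms(1) by (rule reachableE)
  obtain e' where e': "e' \<in> arcs G" "tail G e' = y'" "head G e' = x"
    using adj_sym[OF assms(2)] by (rule reachableE)
  let ?c = "e # q @ [e']"
  have w: "awalk y (q @ [e']) x"
    using awalk_appendI[OF qw(1) arc_implies_awalk[OF e'(1), unfolded e'(2,3)]] .
  then have c: "awalk x ?c x"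
    using e by (simp add: awalk_Cons_iff del: awalk_append_iff)
  have "awlast y q = y'" using qw(1) by (elim awalkE')
  then have "awalk_verts y (q @ [e']) = awalk_verts y q @ [x]"
    unfolding awalk_verts_append[OF w] using e' by simp
  then have "distinct (tl (awalk_verts x ?c))"
    using e(3) xq qw(2) by simp
  then have "cycle ?c" unfolding cycle_def using c by blast
  moreover have "3 \<le> length ?c" using \<open>q \<noteq> []\<close> by (cases q) simp_all
  ultimately show False using acyclic_graph by blast
qed

text \<open>
  A shortest walk from \<open>x\<close> to \<open>z\<close> provides a neighbour \<open>y\<close>
  that is nearer to \<open>z\<close>. If another neighbour \<open>y'\<close> were at most as far
  from \<open>z\<close> as \<open>x\<close>, then the shortest walks from \<open>y\<close> and
  from \<open>y'\<close> to \<open>z\<close> would avoid \<open>x\<close> and could be combined to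
  a bypass of \<open>x\<close>.
\<close>

lemma dist_toward:
  assumes "x \<in> verts G" "z \<in> verts G" "x \<noteq> z"
  shows "\<exists>y \<in> verts G. dist x y = 1 \<and> dist x z = Suc (dist y z) \<and>
    (\<forall>y' \<in> verts G. dist x y' = 1 \<longrightarrow> y' \<noteq> y \<longrightarrow> dist y' z = Suc (dist x z))"
proof -
  obtain p where p: "awalk x p z" "length p = dist x z" using shortest_exists[OF assms(1,2)] by blast
  obtain e p' where pe: "p = e # p'"
  proof (cases p)
    case Nil
    then show ?thesis using p(1) assms(3) by (simp add: awalk_Nil_iff)
  qed
  define y where "y = head G e"
  have e: "e \<in> arcs G" "tail G e = x" "awalk y p' z" using p(1) pe by (simp_all add: awalk_Cons_iff y_def)
  have xy: "x \<rightarrow> y" using e(2) in_arcs_imp_in_arcs_ends[OF e(1)] by (simp add: y_def)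
  have yV: "y \<in> verts G" using e(1) by (simp add: y_def)
  have d1: "dist x y = 1" using dist_eq_1 assms yV xy by blast
  have yz: "dist x z = Suc (dist y z)"
    using dist_le[OF e(3)] dist_triangle[OF assms(1) yV assms(2)] p pe d1 by simp
  have avoid: "x \<notin> set (awalk_verts u q)"
    if u: "awalk u q z" "length q = dist u z" "dist u z \<le> dist x z" "u \<noteq> x" for u q
  proof
    assume "x \<in> set (awalk_verts u q)"
    then obtain q1 q2 where q: "q = q1 @ q2" "awalk u q1 x" "awalk x q2 z"
      using awalk_decomp[OF u(1)] by metis
    have "q1 \<noteq> []"
    proof
      assume "q1 = []"
      then show False using q(2) u(4) by (simp add: awalk_Nil_iff)
    qed
    then have "length q2 < length q" using q by simp
    then show False using dist_le[OF q(3)] u by linarith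
  qed
  have "dist y' z = Suc (dist x z)" if y': "y' \<in> verts G" "dist x y' = 1" "y' \<noteq> y" for y'
  proof (rule ccontr)
    assume ne: "dist y' z \<noteq> Suc (dist x z)"
    have adj: "x \<rightarrow> y'" using dist_eq_1 assms y' by blast
    have "dist y' x = 1" using dist_sym y' assms by simp
    then have "dist y' z \<le> Suc (dist x z)" using dist_triangle[OF y'(1) assms(1,2)] by simp
    then have le: "dist y' z \<le> dist x z" "dist z y' \<le> dist x z" using ne dist_sym[of y' z] y' assms by auto
    obtain r where r: "awalk y' r z" "length r = dist y' z" using shortest_exists[OF y'(1) assms(2)] by blast
    obtain q where q: "awalk y q z" "length q = dist y z" using shortest_exists[OF yV assms(2)] by blast
    have nx: "x \<notin> set (awalk_verts y q)" "x \<notin> set (awalk_verts y' r)"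
    proof -
      have "y \<noteq> x" "y' \<noteq> x" using adj_not_same xy adj by blast+
      moreover have "dist y z \<le> dist x z" using yz by simp
      ultimately show "x \<notin> set (awalk_verts y q)" "x \<notin> set (awalk_verts y' r)"
        using avoid[OF q] avoid[OF r] le(1) by blast+
    qed
    obtain r' where r': "awalk z r' y'" "x \<notin> set (awalk_verts z r')"
      using awalk_reverse[OF r(1)] nx(2) by metis
    have "x \<notin> set (awalk_verts y (q @ r'))"
      using set_awalk_verts_append[OF q(1) r'(1)] r'(2) nx(1) by blast
    then show False
      using no_bypass[OF xy adj _ awalk_appendI[OF q(1) r'(1)]] y'(3) by blast
  qed
  then show ?thesis using d1 yz yV by blast
qed

sublocale tree_metric "verts G" dist
proof
  show "dist x y = 0 \<longleftrightarrow> x = y" if "x \<in> verts G" "y \<in> verts G" for x y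
    using dist_eq_0 that .
  show "dist x y = dist y x" if "x \<in> verts G" "y \<in> verts G" for x y
    using dist_sym that .
  show "dist x z \<le> dist x y + dist y z" if "x \<in> verts G" "y \<in> verts G" "z \<in> verts G" for x y z
    using dist_triangle that .
qed (use dist_toward in auto)

section \<open>Graph notions in terms of the metric\<close>

lemma nbrs_eq: "x \<in> verts G \<Longrightarrow> nbrs x = {y. x \<rightarrow> y}"
  using dist_eq_1 adj_in_verts by (auto simp: nbrs_def)

lemma out_degree_eq: "x \<in> verts G \<Longrightarrow> out_degree G x = card (nbrs x)"
proof -
  assume x: "x \<in> verts G"
  have "bij_betw (head G) (out_arcs G x) (nbrs x)"
    unfolding bij_betw_def
  proof
    show "inj_on (head G) (out_arcs G x)"
      using no_multi_arcs by (auto simp: inj_on_def arc_to_ends_def)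
    show "head G ` out_arcs G x = nbrs x"
      using nbrs_eq[OF x] by (auto simp: arcs_ends_conv)
  qed
  then show ?thesis unfolding out_degree_def by (rule bij_betw_same_card)
qed

lemma walk_branch:
  assumes "awalk u p v" "x \<in> verts G" "x \<notin> set (awalk_verts u p)"
  shows "toward x u = toward x v"
  using assms
proof (induction p arbitrary: u)
  case Nil
  then show ?case by (auto simp: awalk_Nil_iff)
next
  case (Cons e p)
  then have e: "e \<in> arcs G" "u = tail G e" "awalk (head G e) p v" by (simp_all add: awalk_Cons_iff)
  have ne: "x \<noteq> u" "x \<noteq> head G e" "x \<notin> set (awalk_verts (head G e) p)"
    using Cons.prems e by (auto dest: hd_in_awalk_verts)
  have "head G e \<in> nbrs u" using e nbrs_eq in_arcs_imp_in_arcs_ends by auto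
  then have "toward x u = toward x (head G e)"
    using toward_adjacent[of x u "head G e"] ne e Cons.prems(2) by auto
  then show ?case using Cons.IH e ne Cons.prems by simp
qed

lemma walk_visits_between:
  assumes "awalk u p v" "between u x v"
  shows "x \<in> set (awalk_verts u p)"
proof (rule ccontr)
  assume "x \<notin> set (awalk_verts u p)"
  moreover from this have "x \<noteq> u" "x \<noteq> v"
    using hd_in_awalk_verts(1)[OF assms(1)] last_in_set[OF awalk_verts_non_Nil, of u p] assms(1)
    by (auto elim!: awalkE')
  ultimately show False
    using walk_branch[OF assms(1)] between_toward_neq[OF assms(2)] betweenD[OF assms(2)] by blast
qed

lemma shortest_path_between:
  assumes "shortest_path G u p v" "x \<in> set (awalk_verts u p)"
  shows "between u x v"
proof -
  have p: "awalk u p v" "length p = dist u v" using assms by (auto simp: shortest_path_def)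
  then obtain q r where qr: "p = q @ r" "awalk u q x" "awalk x r v" using awalk_decomp assms by blast
  have V: "u \<in> verts G" "x \<in> verts G" "v \<in> verts G" using qr by auto
  have "dist u x + dist x v \<le> dist u v" using dist_le[OF qr(2)] dist_le[OF qr(3)] p qr by simp
  then show ?thesis using dist_triangle[OF V] V by (simp add: between_def)
qed

text \<open>
  A shortest path consists of exactly the vertices between its ends, so that "all shortest paths"
  may be replaced by betweenness.
\<close>

lemma shortest_paths_meet_iff:
  assumes "u \<in> verts G" "v \<in> verts G"
  shows "(\<forall>p. shortest_path G u p v \<longrightarrow> set (awalk_verts u p) \<inter> A \<noteq> {}) \<longleftrightarrow> (\<exists>x \<in> A. between u x v)"
proof -
  obtain p0 where "shortest_path G u p0 v"
    using shortest_exists[OF assms] by (auto simp: shortest_path_def)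
  then show ?thesis
    using shortest_path_between walk_visits_between unfolding shortest_path_def by blast
qed

text \<open>
  A walk inside \<open>S\<close> that avoids \<open>q\<close> stays in one branch at
  \<open>q\<close>, so that its ends do not have \<open>q\<close> between them. Conversely, in a
  convex set one can always make a step towards another member.
\<close>

lemma connected_iff_convex:
  assumes "S \<subseteq> verts G"
  shows "connected (G \<restriction> S) \<longleftrightarrow> S \<noteq> {} \<and> convex S"
proof -
  let ?R = "(arcs_ends (G \<restriction> S))\<^sup>s"
  have "arcs_ends (G \<restriction> S) = {(a, b). a \<rightarrow> b \<and> a \<in> S \<and> b \<in> S}"
    by (auto simp: arcs_ends_conv)
  then have R: "(a, b) \<in> ?R \<longleftrightarrow> a \<rightarrow> b \<and> a \<in> S \<and> b \<in> S" for a b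
    using adj_sym[of a b] adj_sym[of b a] by (auto simp: symcl_def)
  have "q \<in> S" if "(a, b) \<in> rtrancl_on S ?R" "between a q b" for a b q
  proof (rule ccontr)
    assume q: "q \<notin> S"
    have "toward q a = toward q b"
      using that(1)
    proof (induction rule: rtrancl_on_induct)
      case (step y z)
      have "y \<in> verts G" "y \<noteq> q" "z \<noteq> q" using step.hyps assms q by auto
      moreover have "z \<in> nbrs y" using step.hyps(2) R nbrs_eq[OF \<open>y \<in> verts G\<close>] by simp
      ultimately have "toward q y = toward q z"
        using toward_adjacent betweenD(2)[OF that(2)] by blast
      then show ?case using step.IH by simp
    qed simp
    moreover have "q \<noteq> a" "q \<noteq> b" using q in_rtrancl_on_in_F[OF that(1)] by auto
    ultimately show False using between_toward_neq that(2) by blast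
  qed
  moreover have "(a, b) \<in> rtrancl_on S ?R" if "convex S" "a \<in> S" "b \<in> S" for a b
    using that(2)
  proof (induction "dist a b" arbitrary: a rule: less_induct)
    case less
    show ?case
    proof (cases "a = b")
      case False
      have V: "a \<in> verts G" "b \<in> verts G" using less that assms by auto
      define c where "c = toward a b"
      have "between a c b" using between_first_step V False by (auto simp: c_def)
      then have "c \<in> S" using that(1,3) less.prems unfolding convex_def by blast
      moreover have "dist c b < dist a b" using d_toward_Suc V False by (simp add: c_def)
      moreover have "a \<rightarrow> c" using toward_nbrs V False nbrs_eq by (auto simp: c_def)
      ultimately show ?thesis
        using less.hyps[of c] less.prems R[of a c] converse_rtrancl_on_into_rtrancl_on by metis
    qed (use less in auto)
  qed
  ultimately show ?thesis
    unfolding connected_conv induce_subgraph_verts convex_def by blast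
qed

lemma connected_resolving_set_iff: "connected_resolving_set G S \<longleftrightarrow> conn_res S"
proof -
  have "resolving_set G S \<longleftrightarrow> resolving S" by (simp add: resolving_set_def resolving_def)
  then show ?thesis
    using connected_iff_convex[of S] unfolding connected_resolving_set_def conn_res_def
    by (auto simp: resolving_def)
qed

lemma major_eq: "major_vertices G = Maj"
  using out_degree_eq by (auto simp: major_vertices_def Maj_def)

lemma ends_eq: "end_vertices G = Ends"
  using out_degree_eq by (auto simp: end_vertices_def Ends_def)

lemma terminal_eq: "terminal_vertices G w = terminals w"
  by (simp add: terminal_vertices_def terminals_def ends_eq major_eq)

lemma ter_eq: "w \<in> Maj \<Longrightarrow> ter G w = card (legs w)"
  by (simp add: ter_def terminal_eq card_terminals)

lemma ext_major_eq: "\<M> G = ExtMaj"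
  using ter_eq by (auto simp: ext_major_def ExtMaj_def major_eq)

lemma D_set_eq: "\<D> G = Dset"
proof -
  have "interior_degree_two G = InnerTwo"
  proof -
    have "(\<forall>p. shortest_path G x p l \<longrightarrow> set (awalk_verts x p) \<inter> Maj \<noteq> {}) \<longleftrightarrow>
        (\<exists>m \<in> Maj. between x m l)" if "x \<in> verts G" "l \<in> terminals v" for x l v
      using that EndsD by (intro shortest_paths_meet_iff) (auto simp: terminals_def)
    then have "(\<forall>v \<in> Maj. \<forall>l \<in> terminals v. \<forall>p. shortest_path G x p l \<longrightarrow>
          set (awalk_verts x p) \<inter> Maj \<noteq> {}) \<longleftrightarrow>
        (\<forall>v \<in> Maj. \<forall>l \<in> terminals v. \<exists>m \<in> Maj. between x m l)" if "x \<in> verts G" for x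
      using that by (intro ball_cong refl)
    then show ?thesis
      unfolding interior_degree_two_def InnerTwo_def major_eq terminal_eq
      by (intro Collect_cong conj_cong refl) (simp_all only: out_degree_eq)
  qed
  then show ?thesis using ter_eq by (auto simp: D_set_def Dset_def major_eq)
qed

text \<open>
  A path that starts in \<open>w\<close> does not return to it, hence stays in one branch at
  \<open>w\<close>, namely the leg of its last vertex.
\<close>

lemma terminal_subtree_verts:
  assumes "w \<in> Maj" "v \<in> verts (terminal_subtree G w)"
  shows "v = w \<or> v \<in> verts G \<and> toward w v \<in> legs w"
proof (cases "v = w")
  case False
  then obtain l p where l: "l \<in> terminals w" "apath w p l" "v \<in> set (awalk_verts w p)"
    using assms by (auto simp: terminal_subtree_def terminal_eq)
  then have w: "awalk w p l" "distinct (awalk_verts w p)" by (auto simp: apath_def)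
  then obtain q r where qr: "p = q @ r" "awalk w q v" "awalk v r l" using awalk_decomp l by blast
  have "q \<noteq> []" using qr False by (auto simp: awalk_Nil_iff)
  moreover have "w \<notin> set (awalk_verts v r)"
  proof -
    have "awalk_verts w p = butlast (awalk_verts w q) @ awalk_verts v r"
      using awalk_verts_append2[of w q r l] w(1) qr by auto
    moreover have "w \<in> set (butlast (awalk_verts w q))"
      using \<open>q \<noteq> []\<close> qr(2) by (cases q) (auto simp: awalk_Cons_iff)
    ultimately show ?thesis using w(2) by auto
  qed
  ultimately have "toward w v = toward w l" using walk_branch[OF qr(3)] assms MajD by blast
  then show ?thesis using terminals_toward_legs[OF assms(1) l(1)] qr by auto
qed simp

lemma cdim_at_eqI:
  assumes "\<exists>S. conn_res S \<and> v \<in> S \<and> card S \<le> n" "\<And>S. conn_res S \<Longrightarrow> v \<in> S \<Longrightarrow> n \<le> card S"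
  shows "cdim_at G v = n"
  unfolding cdim_at_def connected_resolving_set_iff
  using assms by (intro Least_equality) (auto intro: le_antisym)

lemma cdim_eqI:
  assumes "\<exists>S. conn_res S \<and> card S \<le> n" "\<And>S. conn_res S \<Longrightarrow> n \<le> card S"
  shows "cdim G = n"
  unfolding cdim_def connected_resolving_set_iff
  using assms by (intro Least_equality) (auto intro: le_antisym)

lemma conn_res_card_pos: "conn_res S \<Longrightarrow> 1 \<le> card S"
  using conn_res_finite by (fastforce simp: conn_res_def Suc_le_eq card_gt_0_iff)

lemma ExtMaj_empty_iff:
  assumes "2 \<le> card (verts G)"
  shows "ExtMaj = {} \<longleftrightarrow> Maj = {}"
proof
  assume "ExtMaj = {}"
  show "Maj = {}"
  proof (rule ccontr)
    assume ne: "Maj \<noteq> {}"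
    then obtain l w where "w \<in> Maj" "l \<in> terminals w"
      using Ends_nonempty[OF assms] Ends_eq_terminals by blast
    then have "legs w \<noteq> {}" using terminals_toward_legs by blast
    then have "w \<in> ExtMaj" using \<open>w \<in> Maj\<close> by (simp add: ExtMaj_def card_gt_0_iff)
    then show False using \<open>ExtMaj = {}\<close> by blast
  qed
qed (simp add: ExtMaj_def)

lemma dist_nearest_major_leg:
  assumes "w \<in> Maj" "v \<in> verts G" "toward w v \<in> legs w" "v \<noteq> w"
  shows "dist_nearest_major G v = dist w v"
  unfolding dist_nearest_major_def major_eq
proof (rule Min_eqI)
  show "dist w v \<in> dist v ` Maj" using assms dist_sym MajD by auto
  fix n assume "n \<in> dist v ` Maj"
  then obtain m where "m \<in> Maj" "n = dist v m" by auto
  then show "dist w v \<le> n"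
    using legs_branch_between[OF assms(1,3,2,4) refl, of m] dist_sym[of w v] assms MajD
    by (auto simp: between_def)
qed simp

end

section \<open>Path graphs\<close>

lemma vwalk_arcs_memD:
  "(a, b) \<in> set (vwalk_arcs xs) \<Longrightarrow> a \<in> set xs \<and> b \<in> set (tl xs)"
  by (induction xs rule: vwalk_arcs.induct) auto

lemma vwalk_arcs_unique_succ:
  assumes "distinct xs" "(a, b) \<in> set (vwalk_arcs xs)" "(a, b') \<in> set (vwalk_arcs xs)"
  shows "b = b'"
  using assms by (induction xs rule: vwalk_arcs.induct) (auto dest: vwalk_arcs_memD)

lemma vwalk_arcs_unique_pred:
  assumes "distinct xs" "(a, b) \<in> set (vwalk_arcs xs)" "(a', b) \<in> set (vwalk_arcs xs)"
  shows "a = a'"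
  using assms by (induction xs rule: vwalk_arcs.induct) (auto dest: vwalk_arcs_memD)

lemma set_vwalk_arcs_map_upt:
  "set (vwalk_arcs (map f [0..<Suc n])) = {(f i, f (Suc i)) |i. i < n}"
proof (induction n)
  case (Suc n)
  have "vwalk_arcs (map f [0..<Suc (Suc n)]) =
      vwalk_arcs (map f [0..<Suc n]) @ [(f n, f (Suc n))]"
    using vwalk_arcs_append[of "map f [0..<Suc n]" "[f (Suc n)]"] by simp
  then show ?case using Suc by (auto simp: less_Suc_eq)
qed simp

context fin_tree
begin

text \<open>
  In a list without repetitions, every vertex has at most one successor and at most one
  predecessor.
\<close>

lemma path_graph_no_major:
  assumes "path_graph G"
  shows "Maj = {}"
proof -
  obtain xs where xs: "distinct xs"
      "arcs_ends G = set (vwalk_arcs xs) \<union> (set (vwalk_arcs xs))\<inverse>"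
    using assms by (auto simp: path_graph_def)
  have "card (nbrs x) \<le> 2" if x: "x \<in> verts G" for x
  proof -
    let ?A = "{y. (x, y) \<in> set (vwalk_arcs xs)}" and ?B = "{y. (y, x) \<in> set (vwalk_arcs xs)}"
    have n: "nbrs x = ?A \<union> ?B" using nbrs_eq[OF x] xs(2) by auto
    then have fin: "finite ?A" "finite ?B" using finite_nbrs[of x] by auto
    have "card ?A \<le> Suc 0" "card ?B \<le> Suc 0"
      using card_le_Suc0_iff_eq[OF fin(1)] card_le_Suc0_iff_eq[OF fin(2)]
        vwalk_arcs_unique_succ[OF xs(1)] vwalk_arcs_unique_pred[OF xs(1)] by blast+
    then show ?thesis using n card_Un_le[of ?A ?B] by simp
  qed
  then show ?thesis by (force simp: Maj_def)
qed

text \<open>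
  By \<open>inj_on_dist_end\<close>, the distances from an end vertex \<open>l\<close> enumerate
  the vertices, and adjacent vertices have consecutive distances.
\<close>

lemma no_major_path_graph:
  assumes "Maj = {}" "2 \<le> card (verts G)"
  shows "path_graph G"
proof -
  obtain l where l: "l \<in> Ends" using Ends_nonempty assms by blast
  then have lV: "l \<in> verts G" using EndsD by blast
  define n where "n = Max (dist l ` verts G)"
  have "n \<in> dist l ` verts G" unfolding n_def using lV by (intro Max_in) auto
  then obtain u where u: "u \<in> verts G" "dist l u = n" by auto
  have "dist l ` verts G = {..n}"
  proof
    show "dist l ` verts G \<subseteq> {..n}" by (auto simp: n_def)
    show "{..n} \<subseteq> dist l ` verts G"
    proof
      fix k assume "k \<in> {..n}"
      then obtain q where "between l q u" "dist l q = k" using between_exists[OF lV u(1)] u(2) by auto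
      then show "k \<in> dist l ` verts G" using betweenD by blast
    qed
  qed
  then have bij: "bij_betw (dist l) (verts G) {..n}"
    using inj_on_dist_end[OF assms(1) l] by (simp add: bij_betw_def)
  define f where "f = inv_into (verts G) (dist l)"
  have f: "bij_betw f {..n} (verts G)" using bij_betw_inv_into[OF bij] by (simp add: f_def)
  have fd: "f (dist l x) = x" if "x \<in> verts G" for x
    using bij that by (simp add: f_def bij_betw_inv_into_left)
  have df: "dist l (f i) = i" "f i \<in> verts G" if "i \<le> n" for i
  proof -
    show "dist l (f i) = i" using bij_betw_inv_into_right[OF bij] that by (simp add: f_def)
    show "f i \<in> verts G" using bij_betwE[OF f] that by simp
  qed
  define xs where "xs = map f [0..<Suc n]"
  have up: "{0..<Suc n} = {..n}" by auto
  have "distinct xs" "set xs = verts G" "xs \<noteq> []"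
    using f unfolding xs_def bij_betw_def distinct_map set_map set_upt up by simp_all
  moreover have "(x, y) \<in> arcs_ends G \<longleftrightarrow> (\<exists>i < n. {x, y} = {f i, f (Suc i)})" for x y
  proof
    assume xy: "x \<rightarrow> y"
    then have V: "x \<in> verts G" "y \<in> verts G" using adj_in_verts by blast+
    have yn: "y \<in> nbrs x" using xy nbrs_eq V by blast
    have le: "dist l x \<le> n" "dist l y \<le> n" using V by (simp_all add: n_def)
    have "dist l y = Suc (dist l x) \<or> dist l x = Suc (dist l y)"
      using nbr_dist_cases[OF V(1) lV yn] dist_sym[OF V(1) lV] dist_sym[OF V(2) lV] by simp
    then show "\<exists>i < n. {x, y} = {f i, f (Suc i)}"
    proof
      assume 1: "dist l y = Suc (dist l x)"
      then have "y = f (Suc (dist l x))" using fd[OF V(2)] by simp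
      then show ?thesis using 1 le fd[OF V(1)] by (intro exI[of _ "dist l x"]) simp
    next
      assume 2: "dist l x = Suc (dist l y)"
      then have "x = f (Suc (dist l y))" using fd[OF V(1)] by simp
      then show ?thesis using 2 le fd[OF V(2)] by (intro exI[of _ "dist l y"]) auto
    qed
  next
    assume "\<exists>i < n. {x, y} = {f i, f (Suc i)}"
    then obtain i where i: "i < n" "{x, y} = {f i, f (Suc i)}" by blast
    have s: "dist l (f (Suc i)) = Suc i" "f (Suc i) \<in> verts G" using df[of "Suc i"] i by simp_all
    have ne: "f (Suc i) \<noteq> l" using s lV by force
    define p where "p = toward (f (Suc i)) l"
    have pV: "p \<in> verts G" unfolding p_def by (rule toward_in_V[OF s(2) lV ne])
    have p: "f (Suc i) \<rightarrow> p" using toward_nbrs[OF s(2) lV ne] nbrs_eq[OF s(2)] by (simp add: p_def)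
    have "dist l p = i"
      using d_toward_Suc[OF s(2) lV ne, folded p_def] s(1) dist_sym[OF s(2) lV] dist_sym[OF pV lV] by simp
    then have "p = f i" using fd[OF pV] by simp
    then have "f (Suc i) \<rightarrow> f i" "f i \<rightarrow> f (Suc i)" using p adj_sym[OF p] by simp_all
    then show "x \<rightarrow> y" using i(2) by (auto simp: doubleton_eq_iff)
  qed
  then have "arcs_ends G = set (vwalk_arcs xs) \<union> (set (vwalk_arcs xs))\<inverse>"
    unfolding xs_def set_vwalk_arcs_map_upt by (auto simp: doubleton_eq_iff)
  ultimately show ?thesis
    unfolding path_graph_def using graph_axioms by blast
qed

section \<open>The connected metric dimension\<close>

lemma cdim_path:
  assumes "2 \<le> card (verts G)" "Maj = {}"
  shows "cdim G = 1"
proof (rule cdim_eqI)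
  obtain l where "l \<in> Ends" using Ends_nonempty assms by blast
  then have "conn_res {l}" using conn_res_end assms by blast
  then show "\<exists>S. conn_res S \<and> card S \<le> 1" by (intro exI[of _ "{l}"]) simp
qed (use conn_res_card_pos in blast)

lemma cdim_at_path_end:
  assumes "Maj = {}" "v \<in> Ends"
  shows "cdim_at G v = 1"
proof (rule cdim_at_eqI)
  show "\<exists>S. conn_res S \<and> v \<in> S \<and> card S \<le> 1"
    using conn_res_end[OF assms] by (intro exI[of _ "{v}"]) simp
qed (use conn_res_card_pos in blast)

lemma cdim_at_path_inner:
  assumes "2 \<le> card (verts G)" "Maj = {}" "v \<in> verts G" "v \<notin> Ends"
  shows "cdim_at G v = 2"
proof -
  have "\<exists>z \<in> verts G. z \<noteq> v"
  proof (rule ccontr)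
    assume "\<not> ?thesis"
    then have "verts G \<subseteq> {v}" by blast
    then show False using card_mono[of "{v}" "verts G"] assms(1) by simp
  qed
  then obtain y where y: "y \<in> nbrs v" using toward_nbrs assms(3) by blast
  show ?thesis
  proof (rule cdim_at_eqI)
    have "card {v, y} \<le> 2" by (simp add: card_insert_if)
    then show "\<exists>S. conn_res S \<and> v \<in> S \<and> card S \<le> 2"
      using conn_res_edge[OF assms(2,3) y] by (intro exI[of _ "{v, y}"]) simp
    show "2 \<le> card S" if "conn_res S" "v \<in> S" for S
      using conn_res_not_end[OF that assms(4)] y by blast
  qed
qed

lemma card_ge_base: "Maj \<noteq> {} \<Longrightarrow> conn_res S \<Longrightarrow> card Dset + card Ends \<le> card S"
  using conn_res_card_lower[of S "{}"] by simp

lemma cdim_not_path: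
  assumes "Maj \<noteq> {}"
  shows "cdim G = card Dset + card Ends"
proof (rule cdim_eqI)
  obtain m where "m \<in> Maj" using assms by blast
  then show "\<exists>S. conn_res S \<and> card S \<le> card Dset + card Ends"
    using conn_res_small[OF assms, of m] Maj_Core by blast
qed (use card_ge_base assms in blast)

text \<open>
  A neighbour of \<open>w\<close> inside \<open>T\<^sub>w\<close> is the first vertex of a leg,
  and as \<open>w\<close> has two legs at least, another one can be left out.
\<close>

lemma Gamma_cases:
  assumes "Maj \<noteq> {}" "v \<in> \<Gamma> G"
  shows "v \<in> Core \<or> (\<exists>w \<in> Maj. 2 \<le> card (legs w) \<and> v \<in> legs w)"
proof -
  have "v \<in> Core \<or> (\<exists>w \<in> Maj. 2 \<le> card (legs w) \<and> v \<in> legs w)"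
    if w: "w \<in> \<M>\<^sub>2 G" "v \<in> closed_nbhd G w" "v \<in> verts (terminal_subtree G w)" for w
  proof -
    have wM: "w \<in> Maj" "2 \<le> card (legs w)"
      using w(1) ter_eq by (auto simp: ext_major2_def ext_major_eq ExtMaj_def)
    have wV: "w \<in> verts G" using wM MajD by blast
    show ?thesis
    proof (cases "v = w")
      case True
      then show ?thesis using wM Maj_Core by blast
    next
      case False
      then have "v \<in> nbrs w" using w(2) nbrs_eq[OF wV] by (auto simp: closed_nbhd_def)
      then have "toward w v = v" by (rule toward_nbr[OF wV])
      then show ?thesis using terminal_subtree_verts[OF wM(1) w(3)] False wM by auto
    qed
  qed
  then show ?thesis
    using assms(2) Core_eq[OF assms(1)]
    unfolding Gamma_set_def D_set_eq ext_major1_def ext_major_eq by blast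
qed

lemma cdim_at_Gamma:
  assumes "Maj \<noteq> {}" "v \<in> \<Gamma> G"
  shows "cdim_at G v = card Dset + card Ends"
  by (rule cdim_at_eqI) (use conn_res_small[OF assms(1) Gamma_cases[OF assms]] card_ge_base[OF assms(1)] in auto)

lemma cdim_at_leg:
  assumes "w \<in> Maj" "v \<in> verts (terminal_subtree G w)" "v \<noteq> w"
  shows "cdim_at G v = card Dset + card Ends + dist_nearest_major G v -
           (if 2 \<le> card (legs w) then 1 else 0)"
proof -
  have v: "v \<in> verts G" "toward w v \<in> legs w"
    using terminal_subtree_verts[OF assms(1,2)] assms(3) by auto
  show ?thesis
    unfolding dist_nearest_major_leg[OF assms(1) v assms(3)]
    using conn_res_leg[OF assms(1) v(2,1) assms(3) refl] by (rule cdim_at_eqI)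
qed

lemma cdim_at_VT1:
  assumes "v \<in> VT1 G - \<Gamma> G"
  shows "cdim_at G v = card Dset + card Ends + dist_nearest_major G v"
proof -
  obtain w where w: "w \<in> \<M>\<^sub>1 G" "v \<in> verts (terminal_subtree G w)" using assms by (auto simp: VT1_def)
  then have "w \<in> Maj" "card (legs w) = 1"
    using ter_eq by (auto simp: ext_major1_def ext_major_eq ExtMaj_def)
  moreover have "v \<noteq> w" using assms w by (auto simp: Gamma_set_def)
  ultimately show ?thesis using cdim_at_leg w by simp
qed

lemma cdim_at_VT2:
  assumes "v \<in> VT2 G - \<Gamma> G"
  shows "cdim_at G v = card Dset + card Ends + dist_nearest_major G v - 1"
proof -
  obtain w where w: "w \<in> \<M>\<^sub>2 G" "v \<in> verts (terminal_subtree G w)" using assms by (auto simp: VT2_def)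
  then have wM: "w \<in> Maj" "2 \<le> card (legs w)"
    using ter_eq by (auto simp: ext_major2_def ext_major_eq ExtMaj_def)
  have "v \<noteq> w"
  proof
    assume "v = w"
    then have "v \<in> closed_nbhd G w \<inter> verts (terminal_subtree G w)"
      using w(2) by (simp add: closed_nbhd_def)
    then have "v \<in> \<Gamma> G" using w(1) unfolding Gamma_set_def by blast
    then show False using assms by blast
  qed
  then show ?thesis using cdim_at_leg[OF wM(1) w(2)] wM(2) by simp
qed

end

theorem theorem5p4:
  fixes T :: "('a, 'b) pre_digraph"
  assumes "tree_graph T" and "2 \<le> card (verts T)"
  shows "((path_graph T \<longrightarrow> cdim T = 1) \<and>
         (\<not> path_graph T \<longrightarrow> cdim T = card (\<D> T) + \<sigma> T)) \<and>
         (\<forall>v \<in> verts T.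
         (\<M> T = {} \<and> v \<in> end_vertices T \<longrightarrow> cdim_at T v = 1) \<and>
         (\<M> T = {} \<and> v \<notin> end_vertices T \<longrightarrow> cdim_at T v = 2) \<and>
         (\<M> T \<noteq> {} \<and> v \<in> \<Gamma> T \<longrightarrow> cdim_at T v = card (\<D> T) + \<sigma> T) \<and>
         (\<M> T \<noteq> {} \<and> v \<in> VT1 T - \<Gamma> T \<longrightarrow>
            cdim_at T v = card (\<D> T) + \<sigma> T + dist_nearest_major T v) \<and>
         (\<M> T \<noteq> {} \<and> v \<in> VT2 T - \<Gamma> T \<longrightarrow>
            cdim_at T v = card (\<D> T) + \<sigma> T + dist_nearest_major T v - 1))"
proof -
  interpret fin_tree T using assms(1) by (simp add: tree_graph_iff)
  have D: "\<D> T = Dset" and \<sigma>: "\<sigma> T = card Ends" and ends: "end_vertices T = Ends"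
    using D_set_eq ends_eq by (simp_all add: num_ends_def)
  have M: "\<M> T = {} \<longleftrightarrow> Maj = {}"
    unfolding ext_major_eq by (rule ExtMaj_empty_iff[OF assms(2)])
  have path: "path_graph T \<longleftrightarrow> Maj = {}"
    using path_graph_no_major no_major_path_graph[OF _ assms(2)] by (rule iffI)
  show ?thesis
    unfolding D \<sigma> ends M path
    by (intro conjI ballI impI; (elim conjE)?)
      (use cdim_path[OF assms(2)] cdim_not_path cdim_at_path_end
        cdim_at_path_inner[OF assms(2)] cdim_at_Gamma cdim_at_VT1 cdim_at_VT2 in blast)+
qed

end
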